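(* Let $d\ge 2$ and let $f:\mathbb{R}^d\to\mathbb{R}$ be $M$-strongly self-concordant, $\mu$-strongly convex and $L$-smooth, with $\varkappa=L/\mu$. Consider the random quasi-Newton method (described in the context) started from $\boldsymbol{G}_0=L\boldsymbol{I}_d$ and a point $\boldsymbol{x}_0\in\mathbb{R}^d$ satisfying $M\lambda_0\le\frac{\ln\frac32}{4\varkappa}$. Then for every $\delta\in(0,1)$ there is an integer $k_0=O\left(d\varkappa\ln(d\varkappa/\delta)\right)$ (with an absolute implied constant) such that, with probability at least $1-\delta$ over the random directions $\{\boldsymbol{u}_k\}$, $$\lambda_{k_0+k}\le\left(1-\frac{1}{d\varkappa+1}\right)^{k(k-1)/2}\cdot\left(\frac12\right)^k\cdot\left(1-\frac{1}{2\varkappa}\right)^{k_0}\cdot\lambda_0\qquad\text{for all }k\ge 0.$$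
   Context: A twice differentiable $f:\mathbb{R}^d\to\mathbb{R}$ is $\mu$-strongly convex and $L$-smooth ($\mu,L>0$) if $\mu \boldsymbol{I}_d\preceq\nabla^2 f(\boldsymbol{x})\preceq L\boldsymbol{I}_d$ for all $\boldsymbol{x}$. Write $\|\boldsymbol{h}\|_{\boldsymbol{z}}=\sqrt{\boldsymbol{h}^\top\nabla^2 f(\boldsymbol{z})\boldsymbol{h}}$. $f$ is $M$-strongly self-concordant ($M>0$) if $\nabla^2 f(\boldsymbol{y})-\nabla^2 f(\boldsymbol{x})\preceq M\|\boldsymbol{y}-\boldsymbol{x}\|_{\boldsymbol{z}}\nabla^2 f(\boldsymbol{w})$ for all $\boldsymbol{x},\boldsymbol{y},\boldsymbol{z},\boldsymbol{w}\in\mathbb{R}^d$. Here $\preceq$ is the Loewner order on symmetric matrices. Local gradient norm: $\lambda_f(\boldsymbol{x})=\sqrt{\nabla f(\boldsymbol{x})^\top[\nabla^2 f(\boldsymbol{x})]^{-1}\nabla f(\boldsymbol{x})}$, and $\lambda_k=\lambda_f(\boldsymbol{x}_k)$. Broyden family: for symmetric $\boldsymbol{G}\succeq\boldsymbol{A}\succ 0$, $\boldsymbol{u}\in\mathbb{R}^d$, $\tau\in\mathbb{R}$, set $\mathrm{Broyd}_\tau(\boldsymbol{G},\boldsymbol{A},\boldsymbol{u})=\boldsymbol{G}$ if $\boldsymbol{G}\boldsymbol{u}=\boldsymbol{A}\boldsymbol{u}$, and otherwise $$\mathrm{Broyd}_\tau(\boldsymbol{G},\boldsymbol{A},\bolds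ymbol{u})=\tau\Big[\boldsymbol{G}-\tfrac{\boldsymbol{A}\boldsymbol{u}\boldsymbol{u}^\top\boldsymbol{G}+\boldsymbol{G}\boldsymbol{u}\boldsymbol{u}^\top\boldsymbol{A}}{\boldsymbol{u}^\top\boldsymbol{A}\boldsymbol{u}}+\big(\tfrac{\boldsymbol{u}^\top\boldsymbol{G}\boldsymbol{u}}{\boldsymbol{u}^\top\boldsymbol{A}\boldsymbol{u}}+1\big)\tfrac{\boldsymbol{A}\boldsymbol{u}\boldsymbol{u}^\top\boldsymbol{A}}{\boldsymbol{u}^\top\boldsymbol{A}\boldsymbol{u}}\Big]+(1-\tau)\Big[\boldsymbol{G}-\tfrac{(\boldsymbol{G}-\boldsymbol{A})\boldsymbol{u}\boldsymbol{u}^\top(\boldsymbol{G}-\boldsymbol{A})}{\boldsymbol{u}^\top(\boldsymbol{G}-\boldsymbol{A})\boldsymbol{u}}\Big].$$ Random quasi-Newton method: given $\boldsymbol{x}_0$ and symmetric $\boldsymbol{G}_0\succeq\nabla^2 f(\boldsymbol{x}_0)$, for $k\ge 0$: (1) $\boldsymbol{x}_{k+1}=\boldsymbol{x}_k-\boldsymbol{G}_k^{-1}\nabla f(\boldsymbol{x}_k)$; (2) $r_k=\|\boldsymbol{x}_{k+1}-\boldsymbol{x}_k\|_{\boldsymbol{x}_k}$, $\tilde{\boldsymbol{G}}_k=(1+Mr_k)\boldsymbol{G}_k$; (3) choose any $\tau_k\in[0,1]$ (possibly depending on the history and on $\boldsymbol{u}_k$, but not on later directions) and draw $\boldsymbol{u}_k\sim\mathcal{D}$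 independently of the past; (4) $\boldsymbol{G}_{k+1}=\mathrm{Broyd}_{\tau_k}(\tilde{\boldsymbol{G}}_k,\nabla^2 f(\boldsymbol{x}_{k+1}),\boldsymbol{u}_k)$. Here $\mathcal{D}$ is a fixed distribution on $\mathbb{R}^d$ (almost surely nonzero) with $\mathbb{E}_{\boldsymbol{u}\sim\mathcal{D}}\frac{\boldsymbol{u}\boldsymbol{u}^\top}{\boldsymbol{u}^\top\boldsymbol{u}}=\frac1d\boldsymbol{I}_d$. *)

theory Defs
  imports "HOL-Probability.Probability"
begin

text \<open>The dimension \<open>d\<close> of the ambient space is \<open>CARD('n)\<close>.\<close>

definition grad :: "(real^'n \<Rightarrow> real) \<Rightarrow> real^'n \<Rightarrow> real^'n" where
  "grad f x = (THE g. GDERIV f x :> g)"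

definition hess :: "(real^'n \<Rightarrow> real) \<Rightarrow> real^'n \<Rightarrow> real^'n^'n" where
  "hess f x = jacobian (grad f) (at x)"

text \<open>Existence of both derivatives (Frechet sense) at every point; it makes \<open>grad\<close> and
  \<open>hess\<close> meaningful everywhere.\<close>

definition twice_differentiable :: "(real^'n \<Rightarrow> real) \<Rightarrow> bool" where
  "twice_differentiable f \<longleftrightarrow>
     (\<forall>x. f differentiable (at x)) \<and> (\<forall>x. grad f differentiable (at x))"

lemma grad_eqI:
  assumes "GDERIV f x :> g"
  shows "grad f x = g"
  unfolding grad_def
proof (rule the_equality[where a = g])
  show "GDERIV f x :> g" by (rule assms)
next
  fix g' assume "GDERIV f x :> g'"
  then have "(\<lambda>h. h \<bullet> g') = (\<lambda>h. h \<bullet> g)"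
    using assms has_derivative_unique unfolding gderiv_def by blast
  then show "g' = g"
    unfolding fun_eq_iff by (rule iffD1[OF vector_eq_ldot])
qed

lemma hess_eqI:
  assumes "(grad f has_derivative (\<lambda>h. H *v h)) (at x)"
  shows "hess f x = H"
  using frechet_derivative_at[OF assms, symmetric]
  unfolding hess_def jacobian_def by (simp only: matrix_of_matrix_vector_mul)

definition pos_semidef :: "real^'n^'n \<Rightarrow> bool" where
  "pos_semidef A \<longleftrightarrow> transpose A = A \<and> (\<forall>h. 0 \<le> h \<bullet> (A *v h))"

definition loewner_le :: "real^'n^'n \<Rightarrow> real^'n^'n \<Rightarrow> bool"  (infix \<open>\<preceq>\<close> 50) where
  "A \<preceq> B \<longleftrightarrow> pos_semidef (B - A)"

text \<open>\<open>mat c\<close> is \<open>c\<close> times the identity matrix. Symmetry of the Hessian is part of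
  the Loewner inequalities.\<close>

definition strongly_convex :: "real \<Rightarrow> (real^'n \<Rightarrow> real) \<Rightarrow> bool" where
  "strongly_convex \<mu> f \<longleftrightarrow> \<mu> > 0 \<and> twice_differentiable f \<and> (\<forall>x. mat \<mu> \<preceq> hess f x)"

definition smooth :: "real \<Rightarrow> (real^'n \<Rightarrow> real) \<Rightarrow> bool" where
  "smooth L f \<longleftrightarrow> L > 0 \<and> twice_differentiable f \<and> (\<forall>x. hess f x \<preceq> mat L)"

definition local_norm :: "(real^'n \<Rightarrow> real) \<Rightarrow> real^'n \<Rightarrow> real^'n \<Rightarrow> real" where
  "local_norm f z h = sqrt (h \<bullet> (hess f z *v h))"

definition strongly_self_concordant :: "real \<Rightarrow> (real^'n \<Rightarrow> real) \<Rightarrow> bool" where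
  "strongly_self_concordant M f \<longleftrightarrow> M > 0 \<and> twice_differentiable f \<and>
     (\<forall>x y z w. hess f y - hess f x \<preceq> (M * local_norm f z (y - x)) *\<^sub>R hess f w)"

definition local_grad_norm :: "(real^'n \<Rightarrow> real) \<Rightarrow> real^'n \<Rightarrow> real" where
  "local_grad_norm f x = sqrt (grad f x \<bullet> (matrix_inv (hess f x) *v grad f x))"

definition outer :: "real^'n \<Rightarrow> real^'n \<Rightarrow> real^'n^'n" where
  "outer u v = (\<chi> i j. u $ i * v $ j)"

definition broyd ::
  "real \<Rightarrow> real^'n^'n \<Rightarrow> real^'n^'n \<Rightarrow> real^'n \<Rightarrow> real^'n^'n" where
  "broyd \<tau> G A u =
    (if G *v u = A *v u then G
     else
       (let uAu = u \<bullet> (A *v u); uGu = u \<bullet> (G *v u); U = outer u u in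
        \<tau> *\<^sub>R (G - (1 / uAu) *\<^sub>R (A ** U ** G + G ** U ** A)
                + ((uGu / uAu + 1) / uAu) *\<^sub>R (A ** U ** A))
        + (1 - \<tau>) *\<^sub>R (G - (1 / (u \<bullet> ((G - A) *v u))) *\<^sub>R ((G - A) ** U ** (G - A)))))"

text \<open>One realisation of the method: iterates \<open>x\<close> and matrices \<open>G\<close> produced by the
  directions \<open>u\<close> and parameters \<open>\<tau>\<close>.\<close>

definition quasi_newton_run ::
  "(real^'n \<Rightarrow> real) \<Rightarrow> real \<Rightarrow> real^'n \<Rightarrow> real^'n^'n \<Rightarrow> (nat \<Rightarrow> real^'n) \<Rightarrow> (nat \<Rightarrow> real)
    \<Rightarrow> (nat \<Rightarrow> real^'n) \<Rightarrow> (nat \<Rightarrow> real^'n^'n) \<Rightarrow> bool" where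
  "quasi_newton_run f M x0 G0 u \<tau> x G \<longleftrightarrow>
     x 0 = x0 \<and> G 0 = G0 \<and>
     (\<forall>k. x (Suc k) = x k - matrix_inv (G k) *v grad f (x k)) \<and>
     (\<forall>k. G (Suc k) =
        broyd (\<tau> k) ((1 + M * local_norm f (x k) (x (Suc k) - x k)) *\<^sub>R G k)
          (hess f (x (Suc k))) (u k))"

definition isotropic_directions :: "(real^'n) measure \<Rightarrow> bool" where
  "isotropic_directions D \<longleftrightarrow>
     prob_space D \<and> sets D = sets borel \<and> (AE u in D. u \<noteq> 0) \<and>
     (\<integral>u. (1 / (u \<bullet> u)) *\<^sub>R outer u u \<partial>D) = mat (1 / real CARD('n))"

text \<open>\<open>F k\<close> is the information available just before \<open>u k\<close> is drawn. The parameter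
  \<open>\<tau> k\<close> may depend on it and on \<open>u k\<close>, that is, on \<open>F (Suc k)\<close>, of which the later
  directions are independent.\<close>

definition direction_sampling ::
  "'w measure \<Rightarrow> (nat \<Rightarrow> 'w measure) \<Rightarrow> (real^'n) measure \<Rightarrow>
    (nat \<Rightarrow> 'w \<Rightarrow> real^'n) \<Rightarrow> (nat \<Rightarrow> 'w \<Rightarrow> real) \<Rightarrow> bool" where
  "direction_sampling P F D u \<tau> \<longleftrightarrow>
     prob_space P \<and> filtration (space P) F \<and> (\<forall>k. subalgebra P (F k)) \<and>
     (\<forall>k. u k \<in> borel_measurable (F (Suc k)) \<and> distr P borel (u k) = D \<and>
          prob_space.indep_set P (sets (F k)) (sets (vimage_algebra (space P) (u k) borel))) \<and>
     (\<forall>k. \<tau> k \<in> borel_measurable (F (Suc k)) \<and> (\<forall>\<omega>\<in>space P. \<tau> k \<omega> \<in> {0..1}))"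

end

theory Submission
  imports Defs
begin

text \<open>
  Write \<open>A\<^sub>k\<close> for the Hessian at \<open>x\<^sub>k\<close>. Along every run \<open>A\<^sub>k \<preceq> G\<^sub>k \<preceq> (3/2) \<kappa> A\<^sub>k\<close>, and
  \<open>\<lambda>\<^sub>k\<close> decays linearly; the start condition leaves slack, so the rate is
  \<open>1 - 0.51 / \<kappa>\<close>, strictly below \<open>q = 1 - 1 / (d \<kappa>)\<close> even for \<open>d = 2\<close>. The gap
  \<open>\<sigma>\<^sub>k = tr (A\<^sub>k\<^sup>-\<^sup>1 (G\<^sub>k - A\<^sub>k))\<close> controls the speed: \<open>\<lambda>\<^sub>k\<^sub>+\<^sub>1\<close> is at most about
  \<open>(\<sigma>\<^sub>k + M \<lambda>\<^sub>k) \<lambda>\<^sub>k\<close>. With \<open>R = (1 + M r\<^sub>k) G\<^sub>k - A\<^sub>k\<^sub>+\<^sub>1\<close>, every member of the Broyden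
  family decreases \<open>tr (A\<^sub>k\<^sub>+\<^sub>1\<^sup>-\<^sup>1 R)\<close> by at least \<open>u\<^sup>T R u / u\<^sup>T A\<^sub>k\<^sub>+\<^sub>1 u\<close>, which isotropy turns
  into the factor \<open>q\<close> in expectation. Hence \<open>E \<sigma>\<^sub>k\<close> is at most \<open>52 d \<kappa> q\<^sup>k\<close>, and Markov's
  inequality with a union bound over \<open>k \<ge> k\<^sub>0\<close> yields the geometric decay of \<open>\<sigma>\<^sub>k\<close>.
\<close>

section \<open>Positive semidefinite matrices\<close>

text \<open>In dimension 2 the linear rate \<open>1 - 1 / (2 * \<kappa>)\<close> of the theorem
  coincides with \<open>q\<close>. The drift in the recursion for the expected gap decays like the
  local gradient norm, so at exactly this rate it would resonate with \<open>q\<close> and produce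
  \<open>k * q ^ k\<close>. The surplus of 51/100 over 1/2 prevents this, and it is the reason for a
  numerical upper bound on ln (3/2).

  The parameter \<open>\<tau> k\<close> may depend on \<open>u k\<close>. This does no harm, because
  the guaranteed decrease of the trace does not involve it. What must be independent of
  \<open>u k\<close> is the residual, and it is: the next point and the rescaled matrix are computed
  before the direction is drawn.

  Arguments usually phrased with eigenvalues or matrix square roots are replaced by Cauchy-Schwarz
  inequalities for quadratic forms and by induction over sums of rank-one matrices. Everything about
  a single realisation is deterministic; probability enters only through one expectation identity
  per step and the final union bound.\<close>

definition pos_def :: "real^'n^'n \<Rightarrow> bool" where
  "pos_def A \<longleftrightarrow> transpose A = A \<and> (\<forall>h. h \<noteq> 0 \<longrightarrow> 0 < h \<bullet> (A *v h))"

lemma dot_symmetric: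
  fixes A :: "real^'n^'n"
  assumes "transpose A = A"
  shows "x \<bullet> (A *v y) = (A *v x) \<bullet> y"
  by (metis assms dot_lmul_matrix transpose_matrix_vector)

lemma transpose_add: "transpose (A + B) = transpose A + transpose (B :: real^'n^'m)"
  and transpose_diff: "transpose (A - B) = transpose A - transpose B"
  and transpose_scaleR: "transpose (c *\<^sub>R A) = c *\<^sub>R transpose A"
  by (simp_all add: transpose_def vec_eq_iff)

lemma mat_vector_mult: "(mat c :: real^'n^'n) *v x = c *\<^sub>R x"
  by (simp add: vec_eq_iff matrix_vector_mult_def mat_def if_distrib[of "\<lambda>z. z * _"] cong: if_cong)

lemma pos_semidefI:
  assumes "transpose A = A" and "\<And>h. 0 \<le> h \<bullet> (A *v h)"
  shows "pos_semidef A"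
  using assms unfolding pos_semidef_def by blast

lemma pos_semidef_transpose: "pos_semidef A \<Longrightarrow> transpose A = A"
  and pos_semidef_ge_0: "pos_semidef A \<Longrightarrow> 0 \<le> h \<bullet> (A *v h)"
  unfolding pos_semidef_def by auto

lemma pos_def_transpose: "pos_def A \<Longrightarrow> transpose A = A"
  and pos_def_gt_0: "pos_def A \<Longrightarrow> h \<noteq> 0 \<Longrightarrow> 0 < h \<bullet> (A *v h)"
  unfolding pos_def_def by auto

lemma pos_def_imp_semidef: "pos_def A \<Longrightarrow> pos_semidef A"
  unfolding pos_def_def pos_semidef_def by (metis inner_zero_left less_eq_real_def)

lemma loewner_leI:
  assumes "transpose A = A" "transpose B = B" and "\<And>h. h \<bullet> (A *v h) \<le> h \<bullet> (B *v h)"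
  shows "A \<preceq> B"
  using assms unfolding loewner_le_def pos_semidef_def
  by (simp add: transpose_diff matrix_vector_mult_diff_rdistrib inner_diff_right)

lemma loewner_leD:
  assumes "A \<preceq> B"
  shows "h \<bullet> (A *v h) \<le> h \<bullet> (B *v h)"
  using pos_semidef_ge_0[OF assms[unfolded loewner_le_def], of h]
  by (simp add: matrix_vector_mult_diff_rdistrib inner_diff_right)

text \<open>The form may be degenerate, so the usual minimiser along \<open>y\<close> need not
  exist. A homogeneous quadratic form in two scalars is used instead: at \<open>c\<close> and
  \<open>b\<close> it equals \<open>c * (a * c - b\<^sup>2)\<close>, and \<open>c = 0\<close> is
  treated apart.\<close>

lemma pos_semidef_Cauchy_Schwarz:
  assumes "pos_semidef A"
  shows "(x \<bullet> (A *v y))\<^sup>2 \<le> (x \<bullet> (A *v x)) * (y \<bullet> (A *v y))"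
proof -
  define a b c where "a = x \<bullet> (A *v x)" and "b = x \<bullet> (A *v y)" and "c = y \<bullet> (A *v y)"
  have b': "y \<bullet> (A *v x) = b"
    unfolding b_def using dot_symmetric[OF pos_semidef_transpose[OF assms]]
    by (metis inner_commute)
  have quad: "0 \<le> s\<^sup>2 * a - 2 * s * t * b + t\<^sup>2 * c" for s t :: real
  proof -
    have "(s *\<^sub>R x - t *\<^sub>R y) \<bullet> (A *v (s *\<^sub>R x - t *\<^sub>R y)) = s\<^sup>2 * a - 2 * s * t * b + t\<^sup>2 * c"
      using b' by (simp add: matrix_vector_mult_diff_distrib matrix_vector_mult_scaleR
          inner_diff_left inner_diff_right a_def b_def c_def power2_eq_square algebra_simps)
    then show ?thesis using pos_semidef_ge_0[OF assms] by metis
  qed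
  have c0: "0 \<le> c" unfolding c_def by (rule pos_semidef_ge_0[OF assms])
  have "b\<^sup>2 \<le> a * c"
  proof (cases "c = 0")
    case True
    show ?thesis
    proof (cases "b = 0")
      case False
      \<comment> \<open>With \<open>c = 0\<close> the form is affine in \<open>t\<close>, and this
        \<open>t\<close> gives it the value -1.\<close>
      then obtain t where "2 * t * b = a + 1"
        using that[of "(a + 1) / (2 * b)"] by simp
      then show ?thesis
        using quad[of 1 t] True by simp
    qed (use True in simp)
  next
    case False
    then have "c > 0" using c0 by simp
    moreover have "0 \<le> c * (a * c - b\<^sup>2)"
      using quad[of c b] by (simp add: power2_eq_square algebra_simps)
    ultimately show ?thesis by (simp add: zero_le_mult_iff)
  qed
  then show ?thesis unfolding a_def b_def c_def .
qed

lemma pos_semidef_kernel: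
  assumes "pos_semidef A" and "x \<bullet> (A *v x) = 0"
  shows "A *v x = 0"
proof -
  have "((A *v x) \<bullet> (A *v x))\<^sup>2 \<le> 0"
    using pos_semidef_Cauchy_Schwarz[OF assms(1), of "A *v x" x] assms(2) by simp
  then show ?thesis by simp
qed

section \<open>Rank-one matrices and traces\<close>

lemma outer_mult_vector: "outer a b *v h = (b \<bullet> h) *\<^sub>R a"
  by (simp add: outer_def matrix_vector_mult_def vec_eq_iff inner_vec_def sum_distrib_left
      sum_distrib_right mult_ac)

lemma transpose_outer: "transpose (outer a b) = outer b a"
  by (simp add: outer_def transpose_def vec_eq_iff mult.commute)

lemma matrix_mult_outer: "(A :: real^'n^'n) ** outer a b = outer (A *v a) b"
  by (simp add: matrix_eq outer_mult_vector matrix_vector_mult_scaleR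
      flip: matrix_vector_mul_assoc)

lemma outer_mult_matrix: "outer a b ** (A :: real^'n^'n) = outer a (transpose A *v b)"
  by (simp add: matrix_eq outer_mult_vector dot_lmul_matrix flip: matrix_vector_mul_assoc)

lemma trace_outer: "trace (outer a b) = a \<bullet> b"
  by (simp add: trace_def outer_def inner_vec_def)

lemma trace_scaleR: "trace (c *\<^sub>R A) = c * trace (A :: real^'n^'n)"
  by (simp add: trace_def sum_distrib_left)

text \<open>By Cauchy-Schwarz the subtracted form never exceeds that of \<open>R\<close>; if
  \<open>u \<bullet> (R *v u) = 0\<close>, division by zero means that nothing is subtracted. The
  matrix serves both as the pivot step of the rank-one decomposition and as the residual of the SR1
  update.\<close>

lemma pos_semidef_deflate:
  assumes "pos_semidef R"
  shows "pos_semidef (R - (1 / (u \<bullet> (R *v u))) *\<^sub>R outer (R *v u) (R *v u))"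
proof (rule pos_semidefI)
  show "transpose (R - (1 / (u \<bullet> (R *v u))) *\<^sub>R outer (R *v u) (R *v u))
      = R - (1 / (u \<bullet> (R *v u))) *\<^sub>R outer (R *v u) (R *v u)"
    using pos_semidef_transpose[OF assms]
    by (simp add: transpose_diff transpose_scaleR transpose_outer)
  fix h
  define a where "a = u \<bullet> (R *v u)"
  have a0: "0 \<le> a" unfolding a_def by (rule pos_semidef_ge_0[OF assms])
  have sym: "(R *v u) \<bullet> h = u \<bullet> (R *v h)"
    using dot_symmetric[OF pos_semidef_transpose[OF assms]] by metis
  have "h \<bullet> ((R - (1 / a) *\<^sub>R outer (R *v u) (R *v u)) *v h) = h \<bullet> (R *v h) - (u \<bullet> (R *v h))\<^sup>2 / a"
    using sym by (simp add: matrix_vector_mult_diff_rdistrib inner_diff_right outer_mult_vector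
        power2_eq_square inner_commute flip: scaleR_matrix_vector_assoc)
  moreover have "(u \<bullet> (R *v h))\<^sup>2 / a \<le> h \<bullet> (R *v h)"
  proof (cases "a = 0")
    case True
    then show ?thesis using pos_semidef_ge_0[OF assms] by simp
  next
    case False
    then show ?thesis
      using pos_semidef_Cauchy_Schwarz[OF assms, of u h] a0
      by (simp add: a_def divide_le_eq mult.commute)
  qed
  ultimately show "0 \<le> h \<bullet> ((R - (1 / (u \<bullet> (R *v u))) *\<^sub>R outer (R *v u) (R *v u)) *v h)"
    by (simp add: a_def)
qed

text \<open>Deflating along a coordinate vector outside the kernel enlarges the set of coordinate
  vectors in the kernel, so the deflation terminates in a sum of rank-one matrices.\<close>

lemma pos_semidef_induct [consumes 1, case_names zero outer]:
  fixes R :: "real^'n^'n"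
  assumes "pos_semidef R" and zero: "Q 0"
    and step: "\<And>R v. pos_semidef R \<Longrightarrow> Q R \<Longrightarrow> Q (R + outer v v)"
  shows "Q R"
  using assms(1)
proof (induction "card {i. R *v axis i 1 \<noteq> 0}" arbitrary: R rule: less_induct)
  case less
  show ?case
  proof (cases "\<exists>i. R *v axis i 1 \<noteq> 0")
    case False
    then have "R *v axis i 1 = 0" for i by blast
    then have "R = 0"
      by (simp add: vec_eq_iff matrix_vector_mul_component inner_axis)
    then show ?thesis using zero by simp
  next
    case True
    then obtain i where i: "R *v axis i 1 \<noteq> 0" by blast
    define e :: "real^'n" where "e = axis i 1"
    define a where "a = e \<bullet> (R *v e)"
    have "a \<noteq> 0" using i pos_semidef_kernel[OF less.prems] unfolding a_def e_def by blast
    then have a: "a > 0"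
      using pos_semidef_ge_0[OF less.prems, of e] unfolding a_def by simp
    define R' where "R' = R - (1 / a) *\<^sub>R outer (R *v e) (R *v e)"
    have psd': "pos_semidef R'"
      unfolding R'_def a_def by (rule pos_semidef_deflate[OF less.prems])
    have R'v: "R' *v h = R *v h - ((e \<bullet> (R *v h)) / a) *\<^sub>R (R *v e)" for h
      using dot_symmetric[OF pos_semidef_transpose[OF less.prems], of e h]
      by (simp add: R'_def matrix_vector_mult_diff_rdistrib outer_mult_vector
          flip: scaleR_matrix_vector_assoc)
    have "R' *v axis i 1 = 0" using R'v[of e] a unfolding a_def e_def by simp
    moreover have "R *v axis j 1 = 0 \<Longrightarrow> R' *v axis j 1 = 0" for j
      by (simp add: R'v)
    ultimately have "{i. R' *v axis i 1 \<noteq> 0} \<subset> {i. R *v axis i 1 \<noteq> 0}"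
      using i by blast
    then have "Q R'" using less.hyps[OF _ psd'] by (simp add: psubset_card_mono)
    moreover have "R = R' + outer ((1 / sqrt a) *\<^sub>R (R *v e)) ((1 / sqrt a) *\<^sub>R (R *v e))"
      using a by (simp add: R'_def outer_def vec_eq_iff field_simps)
    ultimately show ?thesis using step[OF psd'] by metis
  qed
qed

lemma matrix_mult_diff_left: "(A - B) ** C = A ** C - B ** (C :: real^'n^'n)"
  and matrix_mult_diff_right: "C ** (A - B) = C ** A - C ** (B :: real^'n^'n)"
  and matrix_mult_scaleR_right: "C ** (c *\<^sub>R A) = c *\<^sub>R (C ** A)"
  and matrix_mult_scaleR_left: "(c *\<^sub>R A) ** C = c *\<^sub>R (A ** C)"
  by (simp_all add: matrix_eq matrix_vector_mult_diff_rdistrib matrix_vector_mult_diff_distrib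
      matrix_vector_mult_scaleR flip: matrix_vector_mul_assoc scaleR_matrix_vector_assoc)

text \<open>The product is in general not symmetric, but its trace is additive in \<open>R\<close>,
  and a summand \<open>outer v v\<close> contributes \<open>v \<bullet> (B *v v)\<close>.\<close>

lemma pos_semidef_trace_mult_nonneg:
  assumes "pos_semidef B" and "pos_semidef R"
  shows "0 \<le> trace (B ** R)"
  using assms(2)
proof (induction rule: pos_semidef_induct)
  case (outer R v)
  then show ?case
    using pos_semidef_ge_0[OF assms(1), of v]
    by (simp add: matrix_add_ldistrib trace_add matrix_mult_outer trace_outer inner_commute)
qed (simp add: trace_def)

lemma loewner_le_trace_mult:
  assumes "B \<preceq> C" and "pos_semidef R"
  shows "trace (B ** R) \<le> trace (C ** R)" and "trace (R ** B) \<le> trace (R ** C)"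
proof -
  show *: "trace (B ** R) \<le> trace (C ** R)"
    using pos_semidef_trace_mult_nonneg[OF assms[unfolded loewner_le_def]]
    by (simp add: matrix_mult_diff_left trace_sub)
  show "trace (R ** B) \<le> trace (R ** C)"
    using * by (metis trace_mul_sym)
qed

section \<open>Inverses of positive definite matrices\<close>

lemma pos_def_inv:
  assumes "pos_def A"
  shows "invertible A" and "A ** matrix_inv A = mat 1" and "matrix_inv A ** A = mat 1"
proof -
  have "x = 0" if "A *v x = 0" for x
    using pos_def_gt_0[OF assms, of x] that by force
  then have "\<exists>B. B ** A = mat 1" using matrix_left_invertible_ker[of A] by blast
  then obtain B where "B ** A = mat 1" by blast
  then have "A ** B = mat 1 \<and> B ** A = mat 1" using matrix_left_right_inverse by blast
  then have *: "A ** matrix_inv A = mat 1 \<and> matrix_inv A ** A = mat 1"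
    unfolding matrix_inv_def by (rule someI)
  then show "A ** matrix_inv A = mat 1" "matrix_inv A ** A = mat 1" by auto
  show "invertible A" using * unfolding invertible_def by blast
qed

lemma pos_def_mult_inv:
  assumes "pos_def A"
  shows "A *v (matrix_inv A *v x) = x" and "matrix_inv A *v (A *v x) = x"
  using pos_def_inv[OF assms] by (simp_all add: matrix_vector_mul_assoc)

lemma pos_def_matrix_inv:
  assumes "pos_def A"
  shows "pos_def (matrix_inv A)"
proof -
  let ?B = "matrix_inv A"
  have "transpose ?B ** A = mat 1"
    by (metis assms matrix_transpose_mul pos_def_inv(2) pos_def_transpose transpose_mat)
  then have "transpose ?B = ?B"
    by (metis assms matrix_mul_assoc matrix_mul_lid matrix_mul_rid pos_def_inv(2))
  moreover have "0 < h \<bullet> (?B *v h)" if "h \<noteq> 0" for h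
  proof -
    have "?B *v h \<noteq> 0" using that pos_def_mult_inv(1)[OF assms, of h] by force
    then have "0 < (?B *v h) \<bullet> (A *v (?B *v h))" by (rule pos_def_gt_0[OF assms])
    then show ?thesis by (simp add: pos_def_mult_inv(1)[OF assms] inner_commute)
  qed
  ultimately show ?thesis unfolding pos_def_def by blast
qed

lemma pos_def_mono:
  assumes "pos_def A" "A \<preceq> G" "transpose G = G"
  shows "pos_def G"
  using assms unfolding pos_def_def by (meson less_le_trans loewner_leD)

text \<open>Cauchy-Schwarz for the form of the inverse, applied to \<open>v\<close> and
  \<open>A *v h\<close>; the matrices cancel in the mixed term.\<close>

lemma pos_def_dual_Cauchy_Schwarz:
  assumes "pos_def A"
  shows "(v \<bullet> h)\<^sup>2 \<le> (v \<bullet> (matrix_inv A *v v)) * (h \<bullet> (A *v h))"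
  using pos_semidef_Cauchy_Schwarz[OF pos_def_imp_semidef[OF pos_def_matrix_inv[OF assms]],
      of v "A *v h"]
  by (simp add: pos_def_mult_inv[OF assms] inner_commute)

text \<open>With \<open>y = matrix_inv B *v x\<close> the form of \<open>B\<close> at
  \<open>y\<close> is \<open>x \<bullet> y\<close>. Dual Cauchy-Schwarz then bounds
  \<open>(x \<bullet> y)\<^sup>2\<close> by a multiple of \<open>x \<bullet> y\<close>, which
  cancels.\<close>

lemma matrix_inv_antimono:
  assumes A: "pos_def A" and B: "pos_def B" and c: "\<And>h. h \<bullet> (A *v h) \<le> c * (h \<bullet> (B *v h))" "c \<ge> 0"
  shows "x \<bullet> (matrix_inv B *v x) \<le> c * (x \<bullet> (matrix_inv A *v x))"
proof (cases "x = 0")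
  case False
  define y where "y = matrix_inv B *v x"
  have yB: "y \<bullet> (B *v y) = x \<bullet> y"
    by (simp add: y_def pos_def_mult_inv[OF B] inner_commute)
  have pos: "0 < x \<bullet> y"
    unfolding y_def by (rule pos_def_gt_0[OF pos_def_matrix_inv[OF B] False])
  have "(x \<bullet> y)\<^sup>2 \<le> (x \<bullet> (matrix_inv A *v x)) * (y \<bullet> (A *v y))"
    by (rule pos_def_dual_Cauchy_Schwarz[OF A])
  also have "\<dots> \<le> (x \<bullet> (matrix_inv A *v x)) * (c * (x \<bullet> y))"
    using c(1)[of y] pos_semidef_ge_0[OF pos_def_imp_semidef[OF pos_def_matrix_inv[OF A]]]
    by (intro mult_left_mono) (auto simp: yB)
  finally have "(x \<bullet> y) * (x \<bullet> y) \<le> (c * (x \<bullet> (matrix_inv A *v x))) * (x \<bullet> y)"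
    by (simp add: power2_eq_square algebra_simps)
  then show ?thesis using pos unfolding y_def by simp
qed simp

text \<open>The largest relative eigenvalue is at most the sum of all of them. Both sides are
  additive in \<open>R\<close>, and on \<open>outer v v\<close> the claim is dual Cauchy-Schwarz. It
  turns a small trace gap into an upper Loewner bound.\<close>

lemma loewner_le_trace_inv:
  assumes "pos_def A" and "pos_semidef R"
  shows "h \<bullet> (R *v h) \<le> trace (matrix_inv A ** R) * (h \<bullet> (A *v h))"
  using assms(2)
proof (induction rule: pos_semidef_induct)
  case (outer R v)
  then show ?case
    using pos_def_dual_Cauchy_Schwarz[OF assms(1), of v h]
    by (simp add: matrix_add_ldistrib trace_add matrix_mult_outer trace_outer inner_commute
        matrix_vector_mult_add_rdistrib inner_add_right outer_mult_vector algebra_simps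
        power2_eq_square)
qed (simp add: trace_def)

text \<open>Polarisation carries a two-sided bound on the quadratic form over to the bilinear form
  with the same constant, without diagonalising \<open>E\<close> relative to
  \<open>A\<close>.\<close>

lemma bilinear_bound:
  fixes E A :: "real^'n^'n"
  assumes E: "transpose E = E" and A: "pos_def A" and "c \<ge> 0"
    and up: "\<And>h. h \<bullet> (E *v h) \<le> c * (h \<bullet> (A *v h))"
    and lo: "\<And>h. - (h \<bullet> (E *v h)) \<le> c * (h \<bullet> (A *v h))"
  shows "v \<bullet> (E *v s) \<le> c * (sqrt (v \<bullet> (A *v v)) * sqrt (s \<bullet> (A *v s)))"
proof (cases "v = 0 \<or> s = 0")
  case False
  define a b where "a = sqrt (v \<bullet> (A *v v))" and "b = sqrt (s \<bullet> (A *v s))"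
  have ab: "a > 0" "b > 0" and sq: "v \<bullet> (A *v v) = a\<^sup>2" "s \<bullet> (A *v s) = b\<^sup>2"
    using False pos_def_gt_0[OF A] by (auto simp: a_def b_def less_imp_le)
  have sw: "s \<bullet> (E *v v) = v \<bullet> (E *v s)" "s \<bullet> (A *v v) = v \<bullet> (A *v s)"
    using dot_symmetric[OF E] dot_symmetric[OF pos_def_transpose[OF A]]
    by (metis inner_commute)+
  \<comment> \<open>Scaling each vector by the length of the other gives both the length
    \<open>a * b\<close>, so by the parallelogram law the forms of \<open>A\<close> at
    \<open>p\<close> and \<open>q\<close> add up to \<open>4 * (a * b) * (a * b)\<close>.\<close>
  define p q where "p = b *\<^sub>R v + a *\<^sub>R s" and "q = b *\<^sub>R v - a *\<^sub>R s"
  have "4 * (a * b) * (v \<bullet> (E *v s)) = p \<bullet> (E *v p) - q \<bullet> (E *v q)"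
    by (simp add: p_def q_def sw inner_add_left inner_add_right inner_diff_left inner_diff_right
        matrix_vector_mult_diff_distrib matrix_vector_right_distrib matrix_vector_mult_scaleR algebra_simps)
  also have "\<dots> \<le> c * (p \<bullet> (A *v p) + q \<bullet> (A *v q))"
    using up[of p] lo[of q] by (simp add: algebra_simps)
  also have "p \<bullet> (A *v p) + q \<bullet> (A *v q) = 4 * (a * b) * (a * b)"
    by (simp add: p_def q_def sw sq inner_add_left inner_add_right inner_diff_left inner_diff_right
        matrix_vector_mult_diff_distrib matrix_vector_right_distrib matrix_vector_mult_scaleR algebra_simps
        power2_eq_square)
  finally have "4 * (a * b) * (v \<bullet> (E *v s)) \<le> 4 * (a * b) * (c * (a * b))"
    by (simp only: mult_ac)
  then have "v \<bullet> (E *v s) \<le> c * (a * b)"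
    using ab by (subst (asm) mult_le_cancel_left_pos) auto
  then show ?thesis by (simp only: a_def b_def)
qed auto

section \<open>Residuals of the Broyden update\<close>

lemma outer_zero: "outer 0 v = 0" "outer v 0 = 0"
  by (simp_all add: outer_def vec_eq_iff)

text \<open>The congruence \<open>Q\<^sup>T R Q\<close> with
  \<open>Q = I - u u\<^sup>T A / (u\<^sup>T A u)\<close>, multiplied out: what a DFP update leaves
  of \<open>R = G - A\<close>.\<close>

definition dfp_residual :: "real^'n^'n \<Rightarrow> real^'n^'n \<Rightarrow> real^'n \<Rightarrow> real^'n^'n" where
  "dfp_residual R A u =
     R - (1 / (u \<bullet> (A *v u))) *\<^sub>R (outer (A *v u) (R *v u) + outer (R *v u) (A *v u))
       + ((u \<bullet> (R *v u)) / (u \<bullet> (A *v u))\<^sup>2) *\<^sub>R outer (A *v u) (A *v u)"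

definition sr1_residual :: "real^'n^'n \<Rightarrow> real^'n \<Rightarrow> real^'n^'n" where
  "sr1_residual R u = R - (1 / (u \<bullet> (R *v u))) *\<^sub>R outer (R *v u) (R *v u)"

text \<open>Subtracting \<open>A\<close> turns both endpoint updates into low-rank corrections of
  \<open>R = G - A\<close>. The exceptional branch of \<open>broyd\<close> fits the same formula,
  since there \<open>R *v u = 0\<close> and both residuals equal \<open>R\<close>.\<close>

lemma broyd_residual:
  assumes A: "pos_def A" and G: "transpose G = G"
  shows "broyd \<tau> G A u - A = \<tau> *\<^sub>R dfp_residual (G - A) A u + (1 - \<tau>) *\<^sub>R sr1_residual (G - A) u"
proof (cases "G *v u = A *v u")
  case True
  then have "(G - A) *v u = 0" by (simp add: matrix_vector_mult_diff_rdistrib)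
  then have "dfp_residual (G - A) A u = G - A" "sr1_residual (G - A) u = G - A"
    by (simp_all add: dfp_residual_def sr1_residual_def outer_zero)
  then show ?thesis using True by (simp add: broyd_def flip: scaleR_add_left)
next
  case False
  define R where "R = G - A"
  have Rsym: "transpose R = R"
    using pos_def_transpose[OF A] G by (simp add: R_def transpose_diff)
  have "u \<noteq> 0" using False by auto
  then have p: "u \<bullet> (A *v u) \<noteq> 0" using pos_def_gt_0[OF A, of u] by simp
  have GR: "G = A + R" by (simp add: R_def)
  have Gu: "G *v u = A *v u + R *v u" by (simp add: GR matrix_vector_mult_add_rdistrib)
  have dfp: "G - (1 / (u \<bullet> (A *v u))) *\<^sub>R (outer (A *v u) (G *v u) + outer (G *v u) (A *v u))
      + (((u \<bullet> (G *v u)) / (u \<bullet> (A *v u)) + 1) / (u \<bullet> (A *v u))) *\<^sub>R outer (A *v u) (A *v u)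
      = A + dfp_residual R A u"
    unfolding Gu dfp_residual_def using p
    by (simp add: GR outer_def vec_eq_iff inner_add_right field_simps power2_eq_square)
  have sr1: "G - (1 / (u \<bullet> (R *v u))) *\<^sub>R outer (R *v u) (R *v u) = A + sr1_residual R u"
    by (simp add: GR sr1_residual_def)
  have "broyd \<tau> G A u
      = \<tau> *\<^sub>R (G - (1 / (u \<bullet> (A *v u))) *\<^sub>R (outer (A *v u) (G *v u) + outer (G *v u) (A *v u))
      + (((u \<bullet> (G *v u)) / (u \<bullet> (A *v u)) + 1) / (u \<bullet> (A *v u))) *\<^sub>R outer (A *v u) (A *v u))
      + (1 - \<tau>) *\<^sub>R (G - (1 / (u \<bullet> (R *v u))) *\<^sub>R outer (R *v u) (R *v u))"
    using False pos_def_transpose[OF A] G Rsym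
    by (simp add: broyd_def Let_def matrix_mult_outer outer_mult_matrix flip: R_def)
  also have "\<dots> = A + (\<tau> *\<^sub>R dfp_residual R A u + (1 - \<tau>) *\<^sub>R sr1_residual R u)"
    unfolding dfp sr1 by (simp add: algebra_simps)
  finally show ?thesis by (simp add: R_def)
qed

text \<open>DFP removes from \<open>h\<close> its component along \<open>u\<close>, orthogonally
  with respect to \<open>A\<close>, before \<open>R\<close> is evaluated. Positivity and upper
  bounds pass from \<open>R\<close> to the residual through this projection.\<close>

lemma dfp_residual_quadratic:
  assumes A: "transpose A = A" and R: "transpose R = R"
  shows "h \<bullet> (dfp_residual R A u *v h)
    = (h - ((u \<bullet> (A *v h)) / (u \<bullet> (A *v u))) *\<^sub>R u)
        \<bullet> (R *v (h - ((u \<bullet> (A *v h)) / (u \<bullet> (A *v u))) *\<^sub>R u))"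
proof -
  have sw: "(A *v u) \<bullet> h = u \<bullet> (A *v h)" "(R *v u) \<bullet> h = u \<bullet> (R *v h)"
    "h \<bullet> (A *v u) = u \<bullet> (A *v h)" "h \<bullet> (R *v u) = u \<bullet> (R *v h)"
    using dot_symmetric[OF A] dot_symmetric[OF R] by (metis inner_commute)+
  show ?thesis
    unfolding dfp_residual_def
    by (simp add: matrix_vector_mult_diff_rdistrib matrix_vector_mult_add_rdistrib outer_mult_vector
        matrix_vector_mult_diff_distrib matrix_vector_mult_scaleR inner_diff_right inner_diff_left
        inner_add_right sw power2_eq_square diff_divide_distrib algebra_simps
        flip: scaleR_matrix_vector_assoc)
qed

context
  fixes A R :: "real^'n^'n"
  assumes A: "pos_def A" and R: "pos_semidef R"
begin

lemma pos_semidef_dfp_residual: "pos_semidef (dfp_residual R A u)"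
proof (rule pos_semidefI)
  show "transpose (dfp_residual R A u) = dfp_residual R A u"
    using pos_semidef_transpose[OF R]
    by (simp add: dfp_residual_def transpose_diff transpose_add transpose_scaleR transpose_outer add.commute)
qed (simp add: dfp_residual_quadratic pos_def_transpose[OF A] pos_semidef_transpose[OF R]
    pos_semidef_ge_0[OF R])

text \<open>By Pythagoras the projection does not lengthen \<open>h\<close> in the norm of
  \<open>A\<close>, hence the same \<open>e\<close>.\<close>

lemma dfp_residual_le:
  assumes le: "\<And>h. h \<bullet> (R *v h) \<le> e * (h \<bullet> (A *v h))" and "0 \<le> e"
  shows "h \<bullet> (dfp_residual R A u *v h) \<le> e * (h \<bullet> (A *v h))"
proof -
  have "h \<bullet> (dfp_residual R A u *v h) \<le> e * ((h - ((u \<bullet> (A *v h)) / (u \<bullet> (A *v u))) *\<^sub>R u)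
        \<bullet> (A *v (h - ((u \<bullet> (A *v h)) / (u \<bullet> (A *v u))) *\<^sub>R u)))"
    unfolding dfp_residual_quadratic[OF pos_def_transpose[OF A] pos_semidef_transpose[OF R]]
    by (rule le)
  also have "(h - ((u \<bullet> (A *v h)) / (u \<bullet> (A *v u))) *\<^sub>R u)
        \<bullet> (A *v (h - ((u \<bullet> (A *v h)) / (u \<bullet> (A *v u))) *\<^sub>R u))
      = h \<bullet> (A *v h) - (u \<bullet> (A *v h))\<^sup>2 / (u \<bullet> (A *v u))"
  proof -
    have "h \<bullet> (A *v u) = u \<bullet> (A *v h)"
      using dot_symmetric[OF pos_def_transpose[OF A]] by (metis inner_commute)
    then show ?thesis
      by (simp add: matrix_vector_mult_diff_distrib matrix_vector_mult_scaleR inner_diff_right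
          inner_diff_left power2_eq_square algebra_simps)
  qed
  also have "e * \<dots> \<le> e * (h \<bullet> (A *v h))"
    using \<open>0 \<le> e\<close> pos_semidef_ge_0[OF pos_def_imp_semidef[OF A]] by (intro mult_left_mono) auto
  finally show ?thesis .
qed

lemma trace_dfp_residual:
  "trace (matrix_inv A ** dfp_residual R A u)
    = trace (matrix_inv A ** R) - (u \<bullet> (R *v u)) / (u \<bullet> (A *v u))"
proof -
  have "(matrix_inv A *v (R *v u)) \<bullet> (A *v u) = u \<bullet> (R *v u)"
    using dot_symmetric[OF pos_def_transpose[OF pos_def_matrix_inv[OF A]], of "R *v u" "A *v u"]
    by (simp add: pos_def_mult_inv[OF A] inner_commute)
  then have "trace (matrix_inv A ** dfp_residual R A u) = trace (matrix_inv A ** R)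
      - 2 * (u \<bullet> (R *v u)) / (u \<bullet> (A *v u))
      + (u \<bullet> (R *v u)) / (u \<bullet> (A *v u))\<^sup>2 * (u \<bullet> (A *v u))"
    unfolding dfp_residual_def
    by (simp add: matrix_add_ldistrib matrix_mult_diff_right matrix_mult_scaleR_right trace_add trace_sub trace_scaleR matrix_mult_outer
        trace_outer pos_def_mult_inv[OF A])
  then show ?thesis by (simp add: power2_eq_square)
qed

text \<open>SR1 lowers the trace by \<open>c / w\<close>, and dual Cauchy-Schwarz
  \<open>w\<^sup>2 \<le> c * p\<close> makes this at least the DFP decrease \<open>w / p\<close>.
  One decrease thus serves the whole family.\<close>

lemma trace_sr1_residual_le:
  "trace (matrix_inv A ** sr1_residual R u)
    \<le> trace (matrix_inv A ** R) - (u \<bullet> (R *v u)) / (u \<bullet> (A *v u))"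
proof -
  define w p c where "w = u \<bullet> (R *v u)" and "p = u \<bullet> (A *v u)"
    and "c = (matrix_inv A *v (R *v u)) \<bullet> (R *v u)"
  have wp: "0 \<le> w" "0 \<le> p"
    unfolding w_def p_def using pos_semidef_ge_0 R pos_def_imp_semidef[OF A] by blast+
  have "w\<^sup>2 \<le> c * p"
    using pos_def_dual_Cauchy_Schwarz[OF A, of "R *v u" u]
    unfolding w_def p_def c_def by (simp add: inner_commute)
  \<comment> \<open>A vanishing denominator is harmless: \<open>p = 0\<close> forces
    \<open>w = 0\<close>, and \<open>w = 0\<close> makes both quotients 0.\<close>
  moreover from this have "p = 0 \<Longrightarrow> w = 0" by simp
  ultimately have "w / p \<le> c / w"
    using wp by (cases "w = 0"; cases "p = 0") (auto simp: field_simps power2_eq_square)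
  moreover have "trace (matrix_inv A ** sr1_residual R u) = trace (matrix_inv A ** R) - c / w"
    unfolding sr1_residual_def
    by (simp add: matrix_mult_diff_right matrix_mult_scaleR_right trace_sub trace_scaleR matrix_mult_outer trace_outer w_def c_def)
  ultimately show ?thesis by (simp add: w_def p_def)
qed

end

lemma loewner_le_transpose:
  assumes "pos_def A" and "A \<preceq> G"
  shows "transpose G = G"
  using pos_semidef_transpose[OF assms(2)[unfolded loewner_le_def]] pos_def_transpose[OF assms(1)]
  by (simp add: transpose_diff)

context
  fixes A G :: "real^'n^'n" and \<tau> :: real
  assumes A: "pos_def A" and AG: "A \<preceq> G" and \<tau>: "0 \<le> \<tau>" "\<tau> \<le> 1"
begin

lemma broyd_ge: "A \<preceq> broyd \<tau> G A u"
proof -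
  have R: "pos_semidef (G - A)" using AG by (simp add: loewner_le_def)
  have "pos_semidef (\<tau> *\<^sub>R dfp_residual (G - A) A u + (1 - \<tau>) *\<^sub>R sr1_residual (G - A) u)"
    using pos_semidef_dfp_residual[OF A R] pos_semidef_deflate[OF R, of u] \<tau>
    unfolding pos_semidef_def sr1_residual_def[symmetric]
    by (simp add: transpose_add transpose_scaleR matrix_vector_mult_add_rdistrib inner_add_right
        flip: scaleR_matrix_vector_assoc)
  then show ?thesis
    by (simp add: loewner_le_def broyd_residual[OF A loewner_le_transpose[OF A AG]])
qed

text \<open>SR1 only subtracts from the residual and DFP projects it, so the factor
  \<open>\<eta> - 1\<close> survives; the projection argument uses that it is nonnegative.\<close>

lemma broyd_le:
  assumes le: "\<And>h. h \<bullet> (G *v h) \<le> \<eta> * (h \<bullet> (A *v h))" and "1 \<le> \<eta>"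
  shows "h \<bullet> (broyd \<tau> G A u *v h) \<le> \<eta> * (h \<bullet> (A *v h))"
proof -
  have R: "pos_semidef (G - A)" using AG by (simp add: loewner_le_def)
  have Rle: "h \<bullet> ((G - A) *v h) \<le> (\<eta> - 1) * (h \<bullet> (A *v h))" for h
    using le[of h] by (simp add: matrix_vector_mult_diff_rdistrib inner_diff_right algebra_simps)
  have "h \<bullet> (sr1_residual (G - A) u *v h) \<le> h \<bullet> ((G - A) *v h)"
    using pos_semidef_ge_0[OF R, of u]
    by (simp add: sr1_residual_def matrix_vector_mult_diff_rdistrib[of "G - A"] inner_diff_right
        outer_mult_vector inner_commute flip: scaleR_matrix_vector_assoc)
  also note Rle
  finally have sr1: "h \<bullet> (sr1_residual (G - A) u *v h) \<le> (\<eta> - 1) * (h \<bullet> (A *v h))" .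
  have dfp: "h \<bullet> (dfp_residual (G - A) A u *v h) \<le> (\<eta> - 1) * (h \<bullet> (A *v h))"
    by (rule dfp_residual_le[OF A R Rle]) (use \<open>1 \<le> \<eta>\<close> in simp)
  have "h \<bullet> ((broyd \<tau> G A u - A) *v h)
      = \<tau> * (h \<bullet> (dfp_residual (G - A) A u *v h)) + (1 - \<tau>) * (h \<bullet> (sr1_residual (G - A) u *v h))"
    unfolding broyd_residual[OF A loewner_le_transpose[OF A AG]]
    by (simp add: matrix_vector_mult_add_rdistrib inner_add_right flip: scaleR_matrix_vector_assoc)
  also have "\<dots> \<le> (\<eta> - 1) * (h \<bullet> (A *v h))"
    using convex_bound_le[OF dfp sr1, of \<tau> "1 - \<tau>"] \<tau> by simp
  finally show ?thesis
    by (simp add: matrix_vector_mult_diff_rdistrib inner_diff_right algebra_simps)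
qed

lemma trace_broyd_le:
  "trace (matrix_inv A ** (broyd \<tau> G A u - A))
    \<le> trace (matrix_inv A ** (G - A)) - (u \<bullet> ((G - A) *v u)) / (u \<bullet> (A *v u))"
proof -
  have R: "pos_semidef (G - A)" using AG by (simp add: loewner_le_def)
  have "trace (matrix_inv A ** (broyd \<tau> G A u - A))
    = \<tau> * trace (matrix_inv A ** dfp_residual (G - A) A u)
      + (1 - \<tau>) * trace (matrix_inv A ** sr1_residual (G - A) u)"
    unfolding broyd_residual[OF A loewner_le_transpose[OF A AG]]
    by (simp add: matrix_add_ldistrib matrix_mult_scaleR_right trace_add trace_scaleR)
  also have "\<dots> \<le> trace (matrix_inv A ** (G - A)) - (u \<bullet> ((G - A) *v u)) / (u \<bullet> (A *v u))"
    using convex_bound_le[OF eq_refl[OF trace_dfp_residual[OF A R]] trace_sr1_residual_le[OF A R], of \<tau> "1 - \<tau>"] \<tau>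
    by simp
  finally show ?thesis .
qed

end

section \<open>One quasi-Newton step\<close>

text \<open>In relative eigenvalues \<open>\<theta>\<close> of \<open>R = G - A\<close>, which lie
  in \<open>[0, e]\<close>, the model gradient is scaled by
  \<open>\<theta> / (1 + \<theta>)\<close>, at most \<open>e / (1 + e)\<close>. The same bound is
  obtained here from three numbers satisfying \<open>b \<le> e * a\<close> and
  \<open>c \<le> e * b\<close>.\<close>

lemma quasi_newton_step_contraction:
  fixes A G :: "real^'n^'n" and g :: "real^'n"
  assumes A: "pos_def A" and AG: "A \<preceq> G" and up: "\<And>h. h \<bullet> (G *v h) \<le> (1 + e) * (h \<bullet> (A *v h))"
    and e: "0 \<le> e"
  defines "B \<equiv> matrix_inv A" and "s \<equiv> matrix_inv G *v g"
  shows "s \<bullet> (A *v s) \<le> g \<bullet> (B *v g)"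
    and "(g - A *v s) \<bullet> (B *v (g - A *v s)) \<le> (e / (1 + e))\<^sup>2 * (g \<bullet> (B *v g))"
proof -
  define R where "R = G - A"
  have R: "pos_semidef R" using AG by (simp add: R_def loewner_le_def)
  have "pos_def G"
    using pos_def_mono[OF A AG] pos_semidef_transpose[OF R] pos_def_transpose[OF A]
    by (simp add: R_def transpose_diff)
  then have Gs: "G *v s = g" unfolding s_def by (rule pos_def_mult_inv)
  define w where "w = R *v s"
  have g: "g = A *v s + w"
    using Gs by (simp add: w_def R_def matrix_vector_mult_diff_rdistrib)
  note Bsym = dot_symmetric[OF pos_def_transpose[OF pos_def_matrix_inv[OF A]], folded B_def]
  note inv = pos_def_mult_inv[OF A, folded B_def]
  have Bpsd: "pos_semidef B" unfolding B_def by (rule pos_def_imp_semidef[OF pos_def_matrix_inv[OF A]])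
  define a b c where "a = s \<bullet> (A *v s)" and "b = s \<bullet> w" and "c = w \<bullet> (B *v w)"
  have "0 \<le> a" "0 \<le> b" "0 \<le> c"
    using pos_semidef_ge_0[OF pos_def_imp_semidef[OF A]] pos_semidef_ge_0[OF R]
      pos_semidef_ge_0[OF Bpsd] by (auto simp: a_def b_def c_def w_def)
  note nonneg = this
  have gBg: "g \<bullet> (B *v g) = a + 2 * b + c"
  proof -
    have "(A *v s) \<bullet> (B *v w) = b"
      by (simp add: Bsym inv b_def)
    then show ?thesis
      by (simp add: g matrix_vector_right_distrib inner_add_left inner_add_right inv a_def b_def c_def
          inner_commute)
  qed
  have Rle: "h \<bullet> (R *v h) \<le> e * (h \<bullet> (A *v h))" for h
    using up[of h] by (simp add: R_def matrix_vector_mult_diff_rdistrib inner_diff_right algebra_simps)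
  have be: "b \<le> e * a" unfolding a_def b_def w_def by (rule Rle)
  \<comment> \<open>Cauchy-Schwarz in the form of \<open>R\<close>, between \<open>B *v w\<close>
    and \<open>s\<close>; a factor \<open>c\<close> cancels.\<close>
  have ce: "c \<le> e * b"
  proof -
    define y where "y = B *v w"
    have yA: "y \<bullet> (A *v y) = c" by (simp add: y_def inv c_def inner_commute)
    have "c\<^sup>2 = (y \<bullet> (R *v s))\<^sup>2" by (simp add: c_def y_def w_def inner_commute)
    also have "\<dots> \<le> (y \<bullet> (R *v y)) * b"
      unfolding b_def w_def by (rule pos_semidef_Cauchy_Schwarz[OF R])
    also have "\<dots> \<le> (e * c) * b"
      using Rle[of y] nonneg by (intro mult_right_mono) (auto simp: yA)
    finally have "c * c \<le> (e * b) * c" by (simp add: power2_eq_square mult_ac)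
    then show ?thesis
      using nonneg e by (cases "c = 0") auto
  qed
  show "s \<bullet> (A *v s) \<le> g \<bullet> (B *v g)"
    unfolding gBg using nonneg by (simp add: a_def)
  have "c \<le> e * (e * a)" using ce be e by (meson mult_left_mono order_trans)
  moreover have "2 * (e * c) \<le> 2 * (e * (e * b))"
    using ce e by (simp add: mult_left_mono)
  ultimately have "(1 + e)\<^sup>2 * c \<le> e\<^sup>2 * (a + 2 * b + c)"
    by (simp add: power2_eq_square algebra_simps)
  then have "c \<le> (e / (1 + e))\<^sup>2 * (a + 2 * b + c)"
    using e by (simp add: power_divide pos_le_divide_eq mult.commute)
  then show "(g - A *v s) \<bullet> (B *v (g - A *v s)) \<le> (e / (1 + e))\<^sup>2 * (g \<bullet> (B *v g))"
    unfolding gBg by (simp add: g c_def)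
qed

lemma pos_semidef_norm_triangle:
  assumes B: "pos_semidef B"
  shows "sqrt ((x + y) \<bullet> (B *v (x + y))) \<le> sqrt (x \<bullet> (B *v x)) + sqrt (y \<bullet> (B *v y))"
proof (rule real_le_lsqrt)
  define a b where "a = sqrt (x \<bullet> (B *v x))" and "b = sqrt (y \<bullet> (B *v y))"
  have sq: "x \<bullet> (B *v x) = a\<^sup>2" "y \<bullet> (B *v y) = b\<^sup>2" and nn: "0 \<le> a" "0 \<le> b"
    by (simp_all add: a_def b_def pos_semidef_ge_0[OF B])
  have "(x \<bullet> (B *v y))\<^sup>2 \<le> (a * b)\<^sup>2"
    using pos_semidef_Cauchy_Schwarz[OF B, of x y] by (simp add: sq power_mult_distrib)
  then have xy: "x \<bullet> (B *v y) \<le> a * b"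
    by (rule power2_le_imp_le) (simp add: nn)
  have "y \<bullet> (B *v x) = x \<bullet> (B *v y)"
    using dot_symmetric[OF pos_semidef_transpose[OF B], of y x] by (simp only: inner_commute)
  then have "(x + y) \<bullet> (B *v (x + y)) = a\<^sup>2 + 2 * (x \<bullet> (B *v y)) + b\<^sup>2"
    by (simp add: matrix_vector_right_distrib inner_add_left inner_add_right sq)
  also have "\<dots> \<le> (a + b)\<^sup>2" using xy by (simp add: power2_sum)
  finally show "(x + y) \<bullet> (B *v (x + y)) \<le> (sqrt (x \<bullet> (B *v x)) + sqrt (y \<bullet> (B *v y)))\<^sup>2"
    by (simp add: a_def b_def)
  show "0 \<le> sqrt (x \<bullet> (B *v x)) + sqrt (y \<bullet> (B *v y))"
    by (intro add_nonneg_nonneg real_sqrt_ge_zero pos_semidef_ge_0[OF B])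
qed

lemma grad_has_derivative:
  assumes "twice_differentiable f"
  shows "(grad f has_derivative (\<lambda>h. hess f x *v h)) (at x)"
proof -
  obtain F where F: "(grad f has_derivative F) (at x)"
    using assms unfolding twice_differentiable_def differentiable_def by blast
  have "(\<lambda>h. matrix F *v h) = F"
    by (rule matrix_vector_mul(2)[OF has_derivative_linear[OF F]])
  then have *: "(grad f has_derivative (\<lambda>h. matrix F *v h)) (at x)"
    using F by (simp only:)
  show ?thesis unfolding hess_eqI[OF *] by (rule *)
qed

section \<open>Hessian and gradient comparison under strong self-concordance\<close>

locale self_concordant_objective =
  fixes f :: "real^'n \<Rightarrow> real" and M \<mu> L :: real
  assumes ssc: "strongly_self_concordant M f" and sc: "strongly_convex \<mu> f" and sm: "smooth L f"
begin

lemma M_pos: "0 < M" and \<mu>_pos: "0 < \<mu>" and L_pos: "0 < L"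
  and twice_diff: "twice_differentiable f"
  using ssc sc sm unfolding strongly_self_concordant_def strongly_convex_def smooth_def by blast+

lemma transpose_hess: "transpose (hess f x) = hess f x"
proof -
  have "pos_semidef (hess f x - mat \<mu>)"
    using sc unfolding strongly_convex_def loewner_le_def by auto
  from pos_semidef_transpose[OF this] show ?thesis by (simp add: transpose_diff transpose_mat)
qed

lemma hess_ge: "\<mu> * (h \<bullet> h) \<le> h \<bullet> (hess f x *v h)"
proof -
  have "mat \<mu> \<preceq> hess f x" using sc unfolding strongly_convex_def by auto
  from loewner_leD[OF this, of h] show ?thesis by (simp add: mat_vector_mult)
qed

lemma hess_le: "h \<bullet> (hess f x *v h) \<le> L * (h \<bullet> h)"
proof -
  have "hess f x \<preceq> mat L" using sm unfolding smooth_def by auto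
  from loewner_leD[OF this, of h] show ?thesis by (simp add: mat_vector_mult)
qed

lemma pos_def_hess: "pos_def (hess f x)"
  unfolding pos_def_def
  by (auto intro!: transpose_hess less_le_trans[OF _ hess_ge] simp: \<mu>_pos)

lemmas psd_hess = pos_def_imp_semidef[OF pos_def_hess]
lemmas psd_inv_hess = pos_def_imp_semidef[OF pos_def_matrix_inv[OF pos_def_hess]]

lemma local_norm_sq: "(local_norm f z h)\<^sup>2 = h \<bullet> (hess f z *v h)"
  and local_norm_nonneg: "0 \<le> local_norm f z h"
  unfolding local_norm_def using pos_semidef_ge_0[OF psd_hess] by auto

lemma local_grad_norm_sq: "(local_grad_norm f x)\<^sup>2 = grad f x \<bullet> (matrix_inv (hess f x) *v grad f x)"
  and local_grad_norm_nonneg: "0 \<le> local_grad_norm f x"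
  unfolding local_grad_norm_def using pos_semidef_ge_0[OF psd_inv_hess] by auto

lemma hess_diff_le:
  "h \<bullet> ((hess f y - hess f x) *v h) \<le> M * local_norm f z (y - x) * (h \<bullet> (hess f w *v h))"
proof -
  have "hess f y - hess f x \<preceq> (M * local_norm f z (y - x)) *\<^sub>R hess f w"
    using ssc unfolding strongly_self_concordant_def by auto
  from loewner_leD[OF this, of h] show ?thesis by (simp flip: scaleR_matrix_vector_assoc)
qed

lemma local_norm_minus: "local_norm f z (x - y) = local_norm f z (y - x)"
proof -
  have "(x - y) \<bullet> (hess f z *v (x - y)) = (y - x) \<bullet> (hess f z *v (y - x))"
    by (simp add: matrix_vector_mult_diff_distrib inner_diff_left inner_diff_right)
  then show ?thesis by (simp add: local_norm_def)
qed

lemma hess_le_hess: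
  "h \<bullet> (hess f y *v h) \<le> (1 + M * local_norm f z (y - x)) * (h \<bullet> (hess f x *v h))"
  using hess_diff_le[of h y x z x]
  by (simp add: matrix_vector_mult_diff_rdistrib inner_diff_right algebra_simps)

lemma inv_hess_le_inv_hess:
  "v \<bullet> (matrix_inv (hess f x) *v v)
    \<le> (1 + M * local_norm f z (y - x)) * (v \<bullet> (matrix_inv (hess f y) *v v))"
  by (rule matrix_inv_antimono[OF pos_def_hess pos_def_hess hess_le_hess])
    (simp add: M_pos[THEN less_imp_le] local_norm_nonneg)

text \<open>Testing the error \<open>e\<close> against \<open>v = matrix_inv (hess f x) *v e\<close>
  gives its squared dual norm, and the scalar mean value theorem along the segment replaces an
  integral of the Hessian. The price is the constant \<open>M\<close> instead of
  \<open>M / 2\<close>.\<close>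

lemma grad_increment:
  fixes x s :: "real^'n"
  defines "e \<equiv> grad f (x + s) - grad f x - hess f x *v s"
  shows "sqrt (e \<bullet> (matrix_inv (hess f x) *v e)) \<le> M * (local_norm f x s)\<^sup>2"
proof -
  let ?A = "hess f x"
  define v where "v = matrix_inv ?A *v e"
  have vA: "v \<bullet> (?A *v v) = e \<bullet> v"
    by (simp add: v_def pos_def_mult_inv[OF pos_def_hess] inner_commute)
  have d: "((\<lambda>t. v \<bullet> grad f (x + t *\<^sub>R s)) has_derivative (\<lambda>h. h * (v \<bullet> (hess f (x + t *\<^sub>R s) *v s)))) (at t)"
    for t
  proof -
    have "((\<lambda>t. grad f (x + t *\<^sub>R s)) has_derivative (\<lambda>h. hess f (x + t *\<^sub>R s) *v (h *\<^sub>R s))) (at t)"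
      by (rule has_derivative_compose[OF _ grad_has_derivative[OF twice_diff], of "\<lambda>t. x + t *\<^sub>R s" "\<lambda>h. h *\<^sub>R s"])
        (auto intro!: derivative_eq_intros)
    from has_derivative_inner_right[OF this, of v] show ?thesis
      by (simp add: matrix_vector_mult_scaleR)
  qed
  obtain t where t: "0 < t" "t < 1"
    and "v \<bullet> grad f (x + 1 *\<^sub>R s) - v \<bullet> grad f (x + 0 *\<^sub>R s) = (1 - 0) * (v \<bullet> (hess f (x + t *\<^sub>R s) *v s))"
    using mvt_simple[of 0 1 "\<lambda>t. v \<bullet> grad f (x + t *\<^sub>R s)"
        "\<lambda>t h. h * (v \<bullet> (hess f (x + t *\<^sub>R s) *v s))"] has_derivative_at_withinI[OF d] by auto
  then have eq: "v \<bullet> e = v \<bullet> ((hess f (x + t *\<^sub>R s) - ?A) *v s)"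
    by (simp add: e_def inner_diff_right matrix_vector_mult_diff_rdistrib)
  define r where "r = local_norm f x s"
  have r0: "0 \<le> r" by (simp add: r_def local_norm_nonneg)
  have "local_norm f x (t *\<^sub>R s) = t * r"
    using t by (simp add: r_def local_norm_def matrix_vector_mult_scaleR real_sqrt_mult flip: power2_eq_square mult.assoc)
  also have "\<dots> \<le> r" using t r0 by (simp add: mult_left_le_one_le)
  finally have ts: "local_norm f x (t *\<^sub>R s) \<le> r" .
  have "M * local_norm f x (t *\<^sub>R s) * (h \<bullet> (?A *v h)) \<le> M * r * (h \<bullet> (?A *v h))" for h
    using ts M_pos pos_semidef_ge_0[OF psd_hess]
    by (intro mult_right_mono mult_left_mono) auto
  note scale = this
  have up: "h \<bullet> ((hess f (x + t *\<^sub>R s) - ?A) *v h) \<le> M * r * (h \<bullet> (?A *v h))" for h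
    using order_trans[OF hess_diff_le[of h "x + t *\<^sub>R s" x x x]] scale[of h] by simp
  \<comment> \<open>Self-concordance with the two points exchanged; the norm is still taken at
    \<open>x\<close>, which the definition allows.\<close>
  have lo: "- (h \<bullet> ((hess f (x + t *\<^sub>R s) - ?A) *v h)) \<le> M * r * (h \<bullet> (?A *v h))" for h
    using order_trans[OF hess_diff_le[of h x "x + t *\<^sub>R s" x x]] scale[of h]
      local_norm_minus[of x x "x + t *\<^sub>R s"]
    by (simp add: matrix_vector_mult_diff_rdistrib inner_diff_right)
  have "v \<bullet> ((hess f (x + t *\<^sub>R s) - ?A) *v s)
      \<le> M * r * (sqrt (v \<bullet> (?A *v v)) * sqrt (s \<bullet> (?A *v s)))"
    by (rule bilinear_bound[OF _ pos_def_hess _ up lo])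
      (use M_pos r0 in \<open>simp_all add: transpose_diff transpose_hess\<close>)
  then have "e \<bullet> v \<le> (M * r * r) * sqrt (e \<bullet> v)"
    using eq by (simp add: vA r_def local_norm_def inner_commute mult_ac)
  moreover have "0 \<le> e \<bullet> v" unfolding v_def by (rule pos_semidef_ge_0[OF psd_inv_hess])
  ultimately have *: "sqrt (e \<bullet> v) * sqrt (e \<bullet> v) \<le> (M * r * r) * sqrt (e \<bullet> v)"
    by simp
  then have "sqrt (e \<bullet> v) \<le> M * r * r"
  proof (cases "e \<bullet> v = 0")
    case False
    then have "0 < sqrt (e \<bullet> v)" using \<open>0 \<le> e \<bullet> v\<close> by simp
    with * show ?thesis by (rule mult_right_le_imp_le)
  qed (use M_pos r0 in simp)
  then show ?thesis by (simp add: v_def r_def power2_eq_square mult.assoc)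
qed

text \<open>The new gradient splits into what the quadratic model leaves, contracted by
  \<open>1 - 1 / \<eta>\<close>, and a Taylor error of size \<open>M * l * l\<close>, both in the
  metric at \<open>x\<close>. Passing to the metric at \<open>y\<close> costs
  \<open>sqrt (1 + M * r)\<close>, whence the first factor.\<close>

lemma quasi_newton_step:
  fixes x :: "real^'n" and G :: "real^'n^'n"
  assumes AG: "hess f x \<preceq> G" and up: "\<And>h. h \<bullet> (G *v h) \<le> \<eta> * (h \<bullet> (hess f x *v h))"
    and \<eta>: "1 \<le> \<eta>"
  defines "y \<equiv> x - matrix_inv G *v grad f x"
  shows "local_norm f x (y - x) \<le> local_grad_norm f x"
    and "local_grad_norm f y \<le> (1 + M * local_grad_norm f x / 2)
            * (1 - 1 / \<eta> + M * local_grad_norm f x) * local_grad_norm f x"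
proof -
  let ?A = "hess f x" and ?B = "matrix_inv (hess f x)"
  define g s l r where "g = grad f x" and "s = matrix_inv G *v g" and "l = local_grad_norm f x"
    and "r = local_norm f x (y - x)"
  have l0: "0 \<le> l" and r0: "0 \<le> r"
    by (simp_all add: l_def r_def local_grad_norm_nonneg local_norm_nonneg)
  have lB: "g \<bullet> (?B *v g) = l\<^sup>2" by (simp add: l_def g_def local_grad_norm_sq)
  have yx: "y - x = - s" "y = x + (- s)" by (simp_all add: y_def s_def g_def)
  have As: "?A *v (- s) = - (?A *v s)"
    using matrix_vector_mult_diff_distrib[of ?A 0 s] by simp
  have up': "h \<bullet> (G *v h) \<le> (1 + (\<eta> - 1)) * (h \<bullet> (?A *v h))" for h using up[of h] by simp
  note step = quasi_newton_step_contraction[OF pos_def_hess AG up', of g, folded s_def]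
  have "r\<^sup>2 = s \<bullet> (?A *v s)" by (simp add: r_def local_norm_sq yx As)
  also have "\<dots> \<le> l\<^sup>2" using step(1) \<eta> lB by simp
  finally show rl: "r \<le> l" using l0 by (rule power2_le_imp_le)
  define e where "e = grad f y - g + ?A *v s"
  have "sqrt (e \<bullet> (?B *v e)) \<le> M * r\<^sup>2"
    using grad_increment[of x "- s"] by (simp add: e_def g_def r_def yx As)
  also have "\<dots> \<le> M * l * l"
    using rl r0 M_pos by (simp add: power2_eq_square mult_mono)
  finally have e: "sqrt (e \<bullet> (?B *v e)) \<le> M * l * l" .
  have "(g - ?A *v s) \<bullet> (?B *v (g - ?A *v s)) \<le> ((\<eta> - 1) / \<eta>)\<^sup>2 * l\<^sup>2"
    using step(2) \<eta> lB by simp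
  then have "sqrt ((g - ?A *v s) \<bullet> (?B *v (g - ?A *v s))) \<le> sqrt (((\<eta> - 1) / \<eta> * l)\<^sup>2)"
    unfolding power_mult_distrib by (rule real_sqrt_le_mono)
  also have "\<dots> = (1 - 1 / \<eta>) * l" using \<eta> l0 by (simp add: diff_divide_distrib abs_mult)
  finally have main: "sqrt ((g - ?A *v s) \<bullet> (?B *v (g - ?A *v s))) \<le> (1 - 1 / \<eta>) * l" .
  have gy: "grad f y = (g - ?A *v s) + e" by (simp add: e_def)
  have "sqrt (grad f y \<bullet> (?B *v grad f y)) \<le> (1 - 1 / \<eta>) * l + M * l * l"
    using pos_semidef_norm_triangle[OF psd_inv_hess, of "g - ?A *v s" e x] main e unfolding gy by linarith
  then have By: "sqrt (grad f y \<bullet> (?B *v grad f y)) \<le> (1 - 1 / \<eta> + M * l) * l"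
    by (simp add: algebra_simps)
  have "local_grad_norm f y
      \<le> sqrt ((1 + M * r) * (grad f y \<bullet> (?B *v grad f y)))"
    unfolding local_grad_norm_def
    using inv_hess_le_inv_hess[of "grad f y" y x x] local_norm_minus[of x x y]
    by (simp add: r_def)
  also have "\<dots> = sqrt (1 + M * r) * sqrt (grad f y \<bullet> (?B *v grad f y))"
    by (rule real_sqrt_mult)
  also have "\<dots> \<le> (1 + M * l / 2) * ((1 - 1 / \<eta> + M * l) * l)"
  proof (rule mult_mono[OF _ By])
    have "0 \<le> M * l" "M * r \<le> M * l" using M_pos l0 rl by auto
    moreover have "(1 + M * l / 2)\<^sup>2 = 1 + M * l + (M * l / 2)\<^sup>2"
      by (simp add: power2_sum)
    ultimately have "1 + M * r \<le> (1 + M * l / 2)\<^sup>2"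
      using zero_le_power2[of "M * l / 2"] by linarith
    then show "sqrt (1 + M * r) \<le> 1 + M * l / 2"
      using \<open>0 \<le> M * l\<close> by (intro real_le_lsqrt) auto
    show "0 \<le> 1 + M * l / 2" using \<open>0 \<le> M * l\<close> by simp
    show "0 \<le> sqrt (grad f y \<bullet> (?B *v grad f y))"
      using pos_semidef_ge_0[OF psd_inv_hess] by simp
  qed
  finally show "local_grad_norm f y \<le> (1 + M * local_grad_norm f x / 2)
            * (1 - 1 / \<eta> + M * local_grad_norm f x) * local_grad_norm f x"
    by (simp add: l_def mult.assoc)
qed

end

section \<open>Deterministic analysis of a run\<close>

text \<open>At 41/100 the quadratic Taylor polynomial of the exponential is 1.49405, just below 3/2;
  at half that argument the square of its value exceeds 3/2.\<close>

lemma ln_three_halves_le: "ln (3 / 2) \<le> (41 / 100 :: real)"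
proof -
  have "(1.2260125 :: real) \<le> exp (41 / 200)"
    using exp_lower_Taylor_quadratic[of "41 / 200 :: real"] by (simp add: power2_eq_square)
  then have "(1.2260125 :: real) * 1.2260125 \<le> exp (41 / 200) * exp (41 / 200)"
    by (intro mult_mono) auto
  also have "\<dots> = exp (41 / 100)" by (simp flip: exp_add)
  finally have "(3 / 2 :: real) \<le> exp (41 / 100)" by simp
  then have "ln (3 / 2) \<le> ln (exp (41 / 100 :: real))" by (subst ln_le_cancel_iff) auto
  then show ?thesis by simp
qed

text \<open>Cauchy-Schwarz controls off-diagonal entries by diagonal ones. The bound later makes the
  random residual entries integrable.\<close>

lemma pos_semidef_entry_le:
  assumes R: "pos_semidef R" and le: "\<And>h. h \<bullet> (R *v h) \<le> C * (h \<bullet> h)"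
  shows "\<bar>R $ i $ j\<bar> \<le> C"
proof -
  have entry: "R $ k $ l = axis k 1 \<bullet> (R *v axis l 1)" for k l
    by (simp add: inner_axis' matrix_vector_mul_component inner_axis)
  have diag: "0 \<le> R $ k $ k" "R $ k $ k \<le> C" for k
    using pos_semidef_ge_0[OF R, of "axis k 1"] le[of "axis k 1"]
    unfolding entry[symmetric] by (simp_all add: inner_axis_axis)
  have "(R $ i $ j)\<^sup>2 \<le> R $ i $ i * R $ j $ j"
    unfolding entry by (rule pos_semidef_Cauchy_Schwarz[OF R])
  also have "\<dots> \<le> C * C" by (intro mult_mono diag order_trans[OF diag])
  finally have "(R $ i $ j)\<^sup>2 \<le> C\<^sup>2" by (simp only: power2_eq_square)
  then have "\<bar>R $ i $ j\<bar> \<le> \<bar>C\<bar>" by (simp only: abs_le_square_iff)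
  then show ?thesis using diag(1)[of i] diag(2)[of i] by linarith
qed

context self_concordant_objective
begin

lemma condition_number_ge_1: "1 \<le> L / \<mu>"
proof -
  have "\<mu> * ((axis undefined 1 :: real^'n) \<bullet> axis undefined 1) \<le> L * (axis undefined 1 \<bullet> (axis undefined 1 :: real^'n))"
    by (rule order_trans[OF hess_ge hess_le])
  then show ?thesis using \<mu>_pos by (simp add: inner_axis_axis)
qed

lemma inv_hess_loewner_le: "matrix_inv (hess f x) \<preceq> mat (1 / \<mu>)"
proof (rule loewner_leI)
  have one: "pos_def (mat 1 :: real^'n^'n)" by (simp add: pos_def_def transpose_mat)
  have inv_one: "matrix_inv (mat 1 :: real^'n^'n) = mat 1"
    using pos_def_inv(3)[OF one] by simp
  fix h :: "real^'n"
  have "h \<bullet> (matrix_inv (hess f x) *v h) \<le> (1 / \<mu>) * (h \<bullet> (matrix_inv (mat 1) *v h))"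
  proof (rule matrix_inv_antimono[OF one pos_def_hess])
    fix v show "v \<bullet> (mat 1 *v v) \<le> (1 / \<mu>) * (v \<bullet> (hess f x *v v))"
      using hess_ge[of v x] \<mu>_pos by (simp add: field_simps)
  qed (simp add: less_imp_le[OF \<mu>_pos])
  then show "h \<bullet> (matrix_inv (hess f x) *v h) \<le> h \<bullet> (mat (1 / \<mu>) *v h)"
    by (simp add: inv_one mat_vector_mult)
qed (rule pos_def_transpose[OF pos_def_matrix_inv[OF pos_def_hess]] transpose_mat)+

end

locale quasi_newton = self_concordant_objective f M \<mu> L
  for f :: "real^'n \<Rightarrow> real" and M \<mu> L :: real +
  fixes \<kappa> :: real and x0 :: "real^'n" and u :: "nat \<Rightarrow> real^'n" and \<tau> :: "nat \<Rightarrow> real"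
    and x :: "nat \<Rightarrow> real^'n" and G :: "nat \<Rightarrow> real^'n^'n"
  assumes \<kappa>_eq: "\<kappa> = L / \<mu>"
    and run: "quasi_newton_run f M x0 (mat L) u \<tau> x G"
    and \<tau>: "0 \<le> \<tau> k" "\<tau> k \<le> 1"
    and start: "M * local_grad_norm f x0 \<le> ln (3 / 2) / (4 * \<kappa>)"
begin

abbreviation "A k \<equiv> hess f (x k)"
abbreviation "lam k \<equiv> local_grad_norm f (x k)"
abbreviation "rate \<equiv> 1 - 51 / (100 * \<kappa>)"

definition "rho k = M * local_norm f (x k) (x (Suc k) - x k)"
definition "resid k = (1 + rho k) *\<^sub>R G k - A (Suc k)"
definition "gap k = trace (matrix_inv (A k) ** (G k - A k))"
text \<open>The gap after rescaling and moving to the new Hessian, but before the Broyden update: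
  all of it is determined before \<open>u k\<close> is drawn.\<close>

definition "gap_mid k = trace (matrix_inv (A (Suc k)) ** resid k)"

lemma \<kappa>_ge_1: "1 \<le> \<kappa>"
  using condition_number_ge_1 by (simp add: \<kappa>_eq)

lemma x_0: "x 0 = x0" and G_0: "G 0 = mat L"
  and x_Suc: "x (Suc k) = x k - matrix_inv (G k) *v grad f (x k)"
  and G_Suc: "G (Suc k) = broyd (\<tau> k) ((1 + rho k) *\<^sub>R G k) (A (Suc k)) (u k)"
  using run unfolding quasi_newton_run_def rho_def by blast+

lemma rho_nonneg: "0 \<le> rho k"
  using M_pos local_norm_nonneg by (simp add: rho_def)

lemma rate_bounds: "0 \<le> rate" "rate \<le> 1"
  using \<kappa>_ge_1 by (simp_all add: field_simps)

lemma start_le: "M * lam 0 \<le> 41 / (400 * \<kappa>)"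
proof -
  have "M * lam 0 \<le> ln (3 / 2) / (4 * \<kappa>)" using start by (simp add: x_0)
  also have "\<dots> \<le> (41 / 100) / (4 * \<kappa>)"
    using ln_three_halves_le \<kappa>_ge_1 by (intro divide_right_mono) auto
  finally show ?thesis by simp
qed

lemma A_Suc_le: "h \<bullet> (A (Suc k) *v h) \<le> (1 + rho k) * (h \<bullet> (A k *v h))"
  unfolding rho_def by (rule hess_le_hess)

lemma A_le_A_Suc: "h \<bullet> (A k *v h) \<le> (1 + rho k) * (h \<bullet> (A (Suc k) *v h))"
  unfolding rho_def local_norm_minus[of "x k" "x (Suc k)" "x k"] by (rule hess_le_hess)

text \<open>The factor \<open>1 + rho k\<close> compensates the growth of the Hessian that strong
  self-concordance allows, so the Broyden update again starts from an upper bound.\<close>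

lemma A_Suc_loewner_le:
  assumes "A k \<preceq> G k"
  shows "A (Suc k) \<preceq> (1 + rho k) *\<^sub>R G k"
proof (rule loewner_leI)
  show "transpose ((1 + rho k) *\<^sub>R G k) = (1 + rho k) *\<^sub>R G k"
    by (simp add: transpose_scaleR loewner_le_transpose[OF pos_def_hess assms])
  fix h
  have "h \<bullet> (A (Suc k) *v h) \<le> (1 + rho k) * (h \<bullet> (A k *v h))" by (rule A_Suc_le)
  also have "\<dots> \<le> (1 + rho k) * (h \<bullet> (G k *v h))"
    using loewner_leD[OF assms] rho_nonneg by (intro mult_left_mono) auto
  finally show "h \<bullet> (A (Suc k) *v h) \<le> h \<bullet> ((1 + rho k) *\<^sub>R G k *v h)"
    by (simp flip: scaleR_matrix_vector_assoc)
qed (rule transpose_hess)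

text \<open>One factor \<open>1 + rho k\<close> comes from rescaling \<open>G k\<close>, another
  from the change of Hessian; the update adds none. Bounding their product by an exponential lets
  the factors accumulate as a sum.\<close>

lemma invariant_step:
  assumes AG: "A k \<preceq> G k" and up: "\<And>h. h \<bullet> (G k *v h) \<le> \<eta> * (h \<bullet> (A k *v h))" and \<eta>: "1 \<le> \<eta>"
  shows "A (Suc k) \<preceq> G (Suc k)"
    and "h \<bullet> (G (Suc k) *v h) \<le> \<eta> * exp (2 * rho k) * (h \<bullet> (A (Suc k) *v h))"
proof -
  show "A (Suc k) \<preceq> G (Suc k)"
    unfolding G_Suc by (rule broyd_ge[OF pos_def_hess A_Suc_loewner_le[OF AG] \<tau>])
  have sq: "(1 + rho k) * (1 + rho k) \<le> exp (2 * rho k)"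
  proof -
    have "(1 + rho k) * (1 + rho k) \<le> exp (rho k) * exp (rho k)"
      using rho_nonneg by (intro mult_mono) (auto simp: exp_ge_add_one_self)
    then show ?thesis by (simp flip: exp_add)
  qed
  have le: "v \<bullet> ((1 + rho k) *\<^sub>R G k *v v) \<le> \<eta> * exp (2 * rho k) * (v \<bullet> (A (Suc k) *v v))" for v
  proof -
    have "v \<bullet> ((1 + rho k) *\<^sub>R G k *v v) = (1 + rho k) * (v \<bullet> (G k *v v))"
      by (simp flip: scaleR_matrix_vector_assoc)
    also have "\<dots> \<le> (1 + rho k) * (\<eta> * (v \<bullet> (A k *v v)))"
      using rho_nonneg by (intro mult_left_mono up) auto
    also have "\<dots> \<le> (1 + rho k) * (\<eta> * ((1 + rho k) * (v \<bullet> (A (Suc k) *v v))))"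
      using rho_nonneg \<eta> by (intro mult_left_mono A_le_A_Suc) auto
    also have "\<dots> = \<eta> * (v \<bullet> (A (Suc k) *v v)) * ((1 + rho k) * (1 + rho k))" by (simp only: mult_ac)
    also have "\<dots> \<le> \<eta> * (v \<bullet> (A (Suc k) *v v)) * exp (2 * rho k)"
      using \<eta> by (intro mult_left_mono sq mult_nonneg_nonneg pos_semidef_ge_0[OF psd_hess]) simp
    finally show ?thesis by (simp only: mult_ac)
  qed
  have "1 * 1 \<le> \<eta> * exp (2 * rho k)"
    using \<eta> rho_nonneg by (intro mult_mono) auto
  then show "h \<bullet> (G (Suc k) *v h) \<le> \<eta> * exp (2 * rho k) * (h \<bullet> (A (Suc k) *v h))"
    unfolding G_Suc
    by (intro broyd_le[OF pos_def_hess A_Suc_loewner_le[OF AG] \<tau> le]) simp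
qed

text \<open>The coefficient of \<open>1 / \<kappa>\<close> is
  \<open>- 2 / 3 + 41 / 400 + 41 / 800\<close>, about -0.513, and the quadratic term is negative.
  This leaves room for 51/100.\<close>

lemma contraction_factor_le:
  assumes "0 \<le> t" "t \<le> 41 / (400 * \<kappa>)" "1 \<le> \<eta>" "\<eta> \<le> 3 / 2 * \<kappa>"
  shows "(1 + t / 2) * (1 - 1 / \<eta> + t) \<le> rate"
proof -
  define z where "z = 1 / \<kappa>"
  have z: "0 \<le> z" "z \<le> 1" using \<kappa>_ge_1 by (auto simp: z_def)
  have t: "t \<le> 41 / 400 * z" using assms(2) by (simp add: z_def)
  have "1 / (3 / 2 * \<kappa>) \<le> 1 / \<eta>"
    using assms by (intro divide_left_mono) auto
  then have \<eta>: "2 / 3 * z \<le> 1 / \<eta>" by (simp add: z_def)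
  have "(1 + t / 2) * (1 - 1 / \<eta> + t) \<le> (1 + 41 / 800 * z) * (1 - 2 / 3 * z + 41 / 400 * z)"
    using assms t \<eta> z by (intro mult_mono) (auto simp: divide_le_eq)
  also have "\<dots> \<le> 1 - 51 / 100 * z"
    using z by (simp add: algebra_simps)
  finally show ?thesis by (simp add: z_def)
qed

text \<open>The start condition is tailored to this: the geometric series is at most
  \<open>2 * \<kappa>\<close>, so the exponent is at most \<open>4 * \<kappa> * (M * lam 0)\<close>,
  hence at most ln (3/2).\<close>

lemma exp_sum_le:
  assumes "\<And>i. i < k \<Longrightarrow> lam i \<le> rate ^ i * lam 0"
  shows "exp (2 * M * (\<Sum>i<k. lam i)) \<le> 3 / 2"
proof -
  have k0: "0 < \<kappa>" using \<kappa>_ge_1 by simp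
  have "(\<Sum>i<k. lam i) \<le> (\<Sum>i<k. rate ^ i * lam 0)" by (intro sum_mono assms) simp
  also have "\<dots> = (\<Sum>i<k. rate ^ i) * lam 0" by (simp add: sum_distrib_right)
  also have "\<dots> \<le> (2 * \<kappa>) * lam 0"
  proof (rule mult_right_mono[OF _ local_grad_norm_nonneg])
    have "(\<Sum>i<k. rate ^ i) * (1 - rate) = 1 - rate ^ k"
      by (simp add: sum_gp_strict k0 less_imp_neq[OF k0, symmetric])
    also have "\<dots> \<le> 1" using rate_bounds by simp
    finally have "(\<Sum>i<k. rate ^ i) * (51 / (100 * \<kappa>)) \<le> 1" by simp
    then have "(\<Sum>i<k. rate ^ i) \<le> 100 * \<kappa> / 51" using k0 by (simp add: field_simps)
    then show "(\<Sum>i<k. rate ^ i) \<le> 2 * \<kappa>" using k0 by simp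
  qed
  finally have "2 * M * (\<Sum>i<k. lam i) \<le> 2 * M * (2 * \<kappa> * lam 0)"
    using M_pos by (intro mult_left_mono) auto
  also have "\<dots> = 4 * \<kappa> * (M * lam 0)" by simp
  also have "\<dots> \<le> 4 * \<kappa> * (ln (3 / 2) / (4 * \<kappa>))"
    using start k0 by (intro mult_left_mono) (auto simp: x_0)
  also have "\<dots> = ln (3 / 2)" using k0 by simp
  finally have "exp (2 * M * (\<Sum>i<k. lam i)) \<le> exp (ln (3 / 2))" by (simp only: exp_le_cancel_iff)
  also have "\<dots> = 3 / 2" by simp
  finally show ?thesis .
qed

text \<open>The bound on \<open>G k\<close> needs the decay of all earlier gradient norms, and the
  next decay needs the bound on \<open>G k\<close>, so both go through one induction.\<close>

lemma invariant:
  "A k \<preceq> G k \<and> (\<forall>h. h \<bullet> (G k *v h) \<le> \<kappa> * exp (2 * M * (\<Sum>i<k. lam i)) * (h \<bullet> (A k *v h)))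
    \<and> (\<forall>i\<le>k. lam i \<le> rate ^ i * lam 0) \<and> (\<forall>i<k. rho i \<le> M * lam i)"
proof (induction k)
  case 0
  have "A 0 \<preceq> G 0" using sm unfolding G_0 smooth_def by simp
  moreover have "h \<bullet> (G 0 *v h) \<le> \<kappa> * (h \<bullet> (A 0 *v h))" for h
  proof -
    have "h \<bullet> (G 0 *v h) = \<kappa> * (\<mu> * (h \<bullet> h))"
      using \<mu>_pos by (simp add: G_0 mat_vector_mult \<kappa>_eq)
    also have "\<dots> \<le> \<kappa> * (h \<bullet> (A 0 *v h))" using \<kappa>_ge_1 hess_ge by (intro mult_left_mono) auto
    finally show ?thesis .
  qed
  ultimately show ?case by simp
next
  case (Suc k)
  define \<eta> where "\<eta> = \<kappa> * exp (2 * M * (\<Sum>i<k. lam i))"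
  have AG: "A k \<preceq> G k" and up: "\<And>h. h \<bullet> (G k *v h) \<le> \<eta> * (h \<bullet> (A k *v h))"
    and lam: "\<And>i. i \<le> k \<Longrightarrow> lam i \<le> rate ^ i * lam 0"
    using Suc.IH unfolding \<eta>_def by blast+
  have "0 \<le> M * (\<Sum>i<k. lam i)"
    using M_pos by (intro mult_nonneg_nonneg sum_nonneg local_grad_norm_nonneg) auto
  then have "1 * 1 \<le> \<eta>"
    unfolding \<eta>_def using \<kappa>_ge_1 by (intro mult_mono) auto
  then have \<eta>1: "1 \<le> \<eta>" by simp
  have \<eta>2: "\<eta> \<le> 3 / 2 * \<kappa>"
    unfolding \<eta>_def using exp_sum_le[of k] lam \<kappa>_ge_1 by (simp add: mult.commute)
  note step = quasi_newton_step[OF AG up \<eta>1, folded x_Suc]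
  have rho: "rho k \<le> M * lam k"
    unfolding rho_def using step(1) M_pos by simp
  have Mlam: "0 \<le> M * lam k" "M * lam k \<le> 41 / (400 * \<kappa>)"
  proof -
    show "0 \<le> M * lam k" using M_pos local_grad_norm_nonneg by simp
    have "lam k \<le> rate ^ k * lam 0" by (rule lam) simp
    also have "\<dots> \<le> 1 * lam 0"
      by (intro mult_right_mono power_le_one local_grad_norm_nonneg rate_bounds)
    finally have "M * lam k \<le> M * lam 0" using M_pos by simp
    then show "M * lam k \<le> 41 / (400 * \<kappa>)" using start_le by (rule order_trans)
  qed
  have "lam (Suc k) \<le> (1 + M * lam k / 2) * (1 - 1 / \<eta> + M * lam k) * lam k" by (rule step(2))
  also have "\<dots> \<le> rate * lam k"
    by (intro mult_right_mono contraction_factor_le Mlam \<eta>1 \<eta>2 local_grad_norm_nonneg)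
  also have "\<dots> \<le> rate * (rate ^ k * lam 0)"
    by (intro mult_left_mono lam rate_bounds) simp
  finally have "lam (Suc k) \<le> rate ^ Suc k * lam 0" by (simp only: power_Suc mult.assoc)
  then have 3: "\<forall>i\<le>Suc k. lam i \<le> rate ^ i * lam 0" using lam by (metis le_Suc_eq)
  have 2: "h \<bullet> (G (Suc k) *v h) \<le> \<kappa> * exp (2 * M * (\<Sum>i<Suc k. lam i)) * (h \<bullet> (A (Suc k) *v h))" for h
  proof -
    have "h \<bullet> (G (Suc k) *v h) \<le> \<eta> * exp (2 * rho k) * (h \<bullet> (A (Suc k) *v h))"
      by (rule invariant_step(2)[OF AG up \<eta>1])
    also have "\<dots> \<le> \<eta> * exp (2 * (M * lam k)) * (h \<bullet> (A (Suc k) *v h))"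
      using rho \<eta>1 by (intro mult_right_mono mult_left_mono pos_semidef_ge_0[OF psd_hess]) auto
    also have "\<eta> * exp (2 * (M * lam k)) = \<kappa> * exp (2 * M * (\<Sum>i<Suc k. lam i))"
      by (simp add: \<eta>_def algebra_simps exp_add)
    finally show ?thesis .
  qed
  have 4: "\<forall>i<Suc k. rho i \<le> M * lam i" using Suc.IH rho by (metis less_Suc_eq)
  show ?case using invariant_step(1)[OF AG up \<eta>1] 2 3 4 by blast
qed

lemma A_le_G: "A k \<preceq> G k"
  and lam_le: "lam k \<le> rate ^ k * lam 0"
  and rho_le: "rho k \<le> M * lam k"
  using invariant[of k] invariant[of "Suc k"] by blast+

lemma G_le: "h \<bullet> (G k *v h) \<le> 3 / 2 * \<kappa> * (h \<bullet> (A k *v h))"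
proof -
  have "h \<bullet> (G k *v h) \<le> \<kappa> * exp (2 * M * (\<Sum>i<k. lam i)) * (h \<bullet> (A k *v h))"
    using invariant[of k] by blast
  also have "\<dots> \<le> \<kappa> * (3 / 2) * (h \<bullet> (A k *v h))"
    using exp_sum_le[of k, OF lam_le] \<kappa>_ge_1
    by (intro mult_right_mono mult_left_mono pos_semidef_ge_0[OF psd_hess]) auto
  finally show ?thesis by simp
qed

lemma transpose_G: "transpose (G k) = G k"
  by (rule loewner_le_transpose[OF pos_def_hess A_le_G])

lemma pos_def_G: "pos_def (G k)"
  by (rule pos_def_mono[OF pos_def_hess A_le_G transpose_G])

lemma M_lam_le: "M * lam k \<le> 41 / (400 * \<kappa>) * rate ^ k"
proof -
  have "M * lam k \<le> M * (rate ^ k * lam 0)"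
    using M_pos by (intro mult_left_mono lam_le) simp
  also have "\<dots> = M * lam 0 * rate ^ k" by (simp only: mult_ac)
  also have "\<dots> \<le> 41 / (400 * \<kappa>) * rate ^ k"
    by (intro mult_right_mono start_le zero_le_power rate_bounds)
  finally show ?thesis .
qed

section \<open>The trace gap along a run\<close>

lemma pos_semidef_resid: "pos_semidef (resid k)"
  using A_Suc_loewner_le[OF A_le_G] by (simp add: resid_def loewner_le_def)

lemma trace_inv_hess_diff:
  "trace (matrix_inv (hess f y) ** (B - hess f y)) = trace (matrix_inv (hess f y) ** B) - CARD('n)"
  by (simp add: matrix_mult_diff_right trace_sub pos_def_inv[OF pos_def_hess] trace_I)

lemma gap_bounds: "0 \<le> gap k" "gap k + CARD('n) \<le> 3 / 2 * \<kappa> * CARD('n)"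
proof -
  show "0 \<le> gap k"
    unfolding gap_def using A_le_G
    by (intro pos_semidef_trace_mult_nonneg psd_inv_hess) (simp add: loewner_le_def)
  have "G k \<preceq> (3 / 2 * \<kappa>) *\<^sub>R A k"
  proof (rule loewner_leI)
    fix h show "h \<bullet> (G k *v h) \<le> h \<bullet> ((3 / 2 * \<kappa>) *\<^sub>R A k *v h)"
      using G_le[of h k] by (simp flip: scaleR_matrix_vector_assoc)
  qed (simp_all add: transpose_G transpose_scaleR transpose_hess)
  from loewner_le_trace_mult(2)[OF this psd_inv_hess[of "x k"]]
  show "gap k + CARD('n) \<le> 3 / 2 * \<kappa> * CARD('n)"
    by (simp add: gap_def trace_inv_hess_diff matrix_mult_scaleR_right trace_scaleR
        pos_def_inv[OF pos_def_hess] trace_I)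
qed

lemma gap_mid_nonneg: "0 \<le> gap_mid k"
  unfolding gap_mid_def by (intro pos_semidef_trace_mult_nonneg psd_inv_hess pos_semidef_resid)

text \<open>Rescaling and the change of Hessian multiply \<open>gap k + CARD('n)\<close> by at most
  \<open>(1 + rho k)\<^sup>2\<close>. This sum is of order \<open>\<kappa> * CARD('n)\<close> and
  \<open>rho k\<close> of order \<open>rate ^ k / \<kappa>\<close>, so the drift is free of
  \<open>\<kappa>\<close>.\<close>

lemma gap_mid_le: "gap_mid k \<le> gap k + CARD('n) / 2 * rate ^ k"
proof -
  let ?d = "real CARD('n)"
  have "matrix_inv (A (Suc k)) \<preceq> (1 + rho k) *\<^sub>R matrix_inv (A k)"
  proof (rule loewner_leI)
    fix h show "h \<bullet> (matrix_inv (A (Suc k)) *v h) \<le> h \<bullet> ((1 + rho k) *\<^sub>R matrix_inv (A k) *v h)"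
      using matrix_inv_antimono[OF pos_def_hess pos_def_hess A_le_A_Suc, of k h] rho_nonneg[of k]
      by (simp flip: scaleR_matrix_vector_assoc)
  qed (simp_all add: transpose_scaleR pos_def_transpose[OF pos_def_matrix_inv[OF pos_def_hess]])
  from loewner_le_trace_mult(1)[OF this pos_def_imp_semidef[OF pos_def_G]]
  have "trace (matrix_inv (A (Suc k)) ** G k) \<le> (1 + rho k) * (gap k + ?d)"
    by (simp add: matrix_mult_scaleR_left trace_scaleR gap_def trace_inv_hess_diff)
  then have "(1 + rho k) * trace (matrix_inv (A (Suc k)) ** G k) \<le> (1 + rho k) * ((1 + rho k) * (gap k + ?d))"
    using rho_nonneg by (intro mult_left_mono) auto
  moreover have "gap_mid k = (1 + rho k) * trace (matrix_inv (A (Suc k)) ** G k) - ?d"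
    unfolding gap_mid_def resid_def trace_inv_hess_diff
    by (simp add: matrix_mult_scaleR_right trace_scaleR)
  ultimately have "gap_mid k \<le> gap k + rho k * (2 + rho k) * (gap k + ?d)"
    by (simp add: algebra_simps)
  also have "rho k * (2 + rho k) * (gap k + ?d) \<le> (41 / (400 * \<kappa>) * rate ^ k) * (2 + 41 / 400) * (3 / 2 * \<kappa> * ?d)"
  proof (intro mult_mono gap_bounds)
    show 1: "rho k \<le> 41 / (400 * \<kappa>) * rate ^ k" using rho_le M_lam_le by (rule order_trans)
    also have "\<dots> \<le> 41 / 400 * 1"
      using rate_bounds \<kappa>_ge_1 by (intro mult_mono power_le_one) (auto simp: field_simps)
    finally show "2 + rho k \<le> 2 + 41 / 400" by simp
  qed (use rho_nonneg[of k] gap_bounds(1)[of k] rate_bounds \<kappa>_ge_1 in auto)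
  also have "\<dots> = (41 / 400 * (2 + 41 / 400) * 3 / 2) * (?d * rate ^ k)"
    using \<kappa>_ge_1 by simp
  also have "\<dots> \<le> 1 / 2 * (?d * rate ^ k)"
    using rate_bounds by (intro mult_right_mono) auto
  finally show ?thesis by simp
qed

text \<open>Isotropy averages quotients by \<open>u k \<bullet> u k\<close>, not by the Hessian
  form; exchanging the denominators costs the factor \<open>1 / L\<close>.\<close>

lemma gap_Suc_le:
  "gap (Suc k) \<le> gap_mid k - (1 / L) * ((u k \<bullet> (resid k *v u k)) / (u k \<bullet> u k))"
proof -
  have "gap (Suc k) \<le> gap_mid k - (u k \<bullet> (resid k *v u k)) / (u k \<bullet> (A (Suc k) *v u k))"
    unfolding gap_def gap_mid_def resid_def G_Suc
    by (rule trace_broyd_le[OF pos_def_hess A_Suc_loewner_le[OF A_le_G] \<tau>])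
  moreover have "(1 / L) * ((u k \<bullet> (resid k *v u k)) / (u k \<bullet> u k))
      \<le> (u k \<bullet> (resid k *v u k)) / (u k \<bullet> (A (Suc k) *v u k))"
  proof (cases "u k = 0")
    case False
    have "(u k \<bullet> (resid k *v u k)) / (L * (u k \<bullet> u k))
        \<le> (u k \<bullet> (resid k *v u k)) / (u k \<bullet> (A (Suc k) *v u k))"
      using pos_def_gt_0[OF pos_def_hess False] False L_pos
      by (intro divide_left_mono hess_le pos_semidef_ge_0[OF pos_semidef_resid]) auto
    then show ?thesis by simp
  qed simp
  ultimately show ?thesis by linarith
qed

lemma trace_resid_ge: "\<mu> * gap_mid k \<le> trace (resid k)"
proof -
  have "gap_mid k \<le> trace (mat (1 / \<mu>) ** resid k)"
    unfolding gap_mid_def by (rule loewner_le_trace_mult(1)[OF inv_hess_loewner_le pos_semidef_resid])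
  also have "mat (1 / \<mu>) ** resid k = (1 / \<mu>) *\<^sub>R resid k"
    by (simp add: matrix_eq mat_vector_mult flip: matrix_vector_mul_assoc scaleR_matrix_vector_assoc)
  finally show ?thesis using \<mu>_pos by (simp add: trace_scaleR field_simps)
qed

lemma resid_entry_le: "\<bar>resid k $ i $ j\<bar> \<le> 2 * (3 / 2 * \<kappa> * L)"
proof (rule pos_semidef_entry_le[OF pos_semidef_resid])
  fix h
  have "41 / (400 * \<kappa>) * rate ^ k \<le> 41 / (400 * \<kappa>) * 1"
    using rate_bounds \<kappa>_ge_1 by (intro mult_left_mono power_le_one) auto
  also have "\<dots> \<le> 1" using \<kappa>_ge_1 by simp
  finally have rho: "rho k \<le> 1" using rho_le[of k] M_lam_le[of k] by linarith
  have G: "h \<bullet> (G k *v h) \<le> 3 / 2 * \<kappa> * (L * (h \<bullet> h))"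
    by (rule order_trans[OF G_le mult_left_mono[OF hess_le]]) (use \<kappa>_ge_1 in simp)
  have "h \<bullet> (resid k *v h) \<le> (1 + rho k) * (h \<bullet> (G k *v h))"
    using pos_semidef_ge_0[OF psd_hess, of h "x (Suc k)"]
    by (simp add: resid_def matrix_vector_mult_diff_rdistrib inner_diff_right flip: scaleR_matrix_vector_assoc)
  also have "\<dots> \<le> 2 * (3 / 2 * \<kappa> * (L * (h \<bullet> h)))"
    using rho rho_nonneg[of k] G pos_semidef_ge_0[OF pos_def_imp_semidef[OF pos_def_G], of h k]
    by (intro mult_mono) simp_all
  finally show "h \<bullet> (resid k *v h) \<le> 2 * (3 / 2 * \<kappa> * L) * (h \<bullet> h)" by (simp only: mult.assoc)
qed

text \<open>The gap bounds \<open>G k\<close> by \<open>1 + gap k\<close> times the Hessian, so the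
  step estimate applies with \<open>\<eta> = 1 + gap k\<close>, and a small gap makes the
  contraction factor itself small.\<close>

lemma lam_Suc_le_gap: "lam (Suc k) \<le> (1 + M * lam k / 2) * (gap k + M * lam k) * lam k"
proof -
  have R: "pos_semidef (G k - A k)" using A_le_G by (simp add: loewner_le_def)
  have up: "h \<bullet> (G k *v h) \<le> (1 + gap k) * (h \<bullet> (A k *v h))" for h
    using loewner_le_trace_inv[OF pos_def_hess R, of h "x k"]
    by (simp add: gap_def matrix_vector_mult_diff_rdistrib inner_diff_right algebra_simps)
  have Ml: "0 \<le> M * lam k" using M_pos local_grad_norm_nonneg by simp
  have "lam (Suc k) \<le> (1 + M * lam k / 2) * (1 - 1 / (1 + gap k) + M * lam k) * lam k"
    using quasi_newton_step(2)[OF A_le_G up, folded x_Suc] gap_bounds(1)[of k] by simp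
  also have "\<dots> \<le> (1 + M * lam k / 2) * (gap k + M * lam k) * lam k"
  proof (intro mult_right_mono mult_left_mono local_grad_norm_nonneg)
    show "1 - 1 / (1 + gap k) + M * lam k \<le> gap k + M * lam k"
      using gap_bounds(1)[of k] by (simp add: field_simps)
  qed (use Ml in simp)
  finally show ?thesis .
qed

text \<open>Step \<open>k\<close> after the initial phase contributes a factor
  \<open>s ^ k / 2\<close>, and the exponents 0 to \<open>k - 1\<close> add up to
  \<open>k * (k - 1) div 2\<close>.\<close>

lemma superlinear:
  fixes k0 :: nat and d :: real
  defines "s \<equiv> 1 - 1 / (d * \<kappa> + 1)"
  assumes d: "2 \<le> d" and small: "\<And>j. gap (k0 + j) \<le> s ^ j / 4"
  shows "lam (k0 + k) \<le> s ^ (k * (k - 1) div 2) * (1 / 2) ^ k * (1 - 1 / (2 * \<kappa>)) ^ k0 * lam 0"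
proof (induction k)
  case 0
  have "lam k0 \<le> rate ^ k0 * lam 0" by (rule lam_le)
  also have "\<dots> \<le> (1 - 1 / (2 * \<kappa>)) ^ k0 * lam 0"
    using rate_bounds \<kappa>_ge_1 by (intro mult_right_mono power_mono local_grad_norm_nonneg) (auto simp: field_simps)
  finally show ?case by simp
next
  case (Suc k)
  \<comment> \<open>The linear rate must not exceed \<open>s\<close>, so that \<open>t\<close> also
    decays like \<open>s ^ k\<close>.\<close>
  have "2 * \<kappa> \<le> d * \<kappa>" using d \<kappa>_ge_1 by simp
  then have "1 / (d * \<kappa> + 1) \<le> 1 / (2 * \<kappa>)"
    using \<kappa>_ge_1 by (intro frac_le) linarith+
  also have "\<dots> \<le> 51 / (100 * \<kappa>)" using \<kappa>_ge_1 by (simp add: field_simps)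
  finally have rs: "rate \<le> s" by (simp add: s_def)
  then have s0: "0 \<le> s" using rate_bounds by linarith
  define l where "l = lam (k0 + k)"
  define t where "t = M * l"
  have t0: "0 \<le> t" using M_pos local_grad_norm_nonneg by (simp add: t_def l_def)
  have "t \<le> 41 / (400 * \<kappa>) * rate ^ (k0 + k)" unfolding t_def l_def by (rule M_lam_le)
  also have "\<dots> \<le> 41 / 400 * (1 * s ^ k)"
    unfolding power_add using rate_bounds \<kappa>_ge_1 s0 rs
    by (intro mult_mono power_le_one power_mono) (auto simp: field_simps)
  finally have t: "t \<le> 41 / 400 * s ^ k" by simp
  have "s ^ k \<le> 1" using s0 d \<kappa>_ge_1 by (intro power_le_one) (auto simp: s_def)
  then have t1: "t \<le> 41 / 400" using t by simp
  have "lam (k0 + Suc k) \<le> (1 + t / 2) * (gap (k0 + k) + t) * l"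
    using lam_Suc_le_gap[of "k0 + k"] by (simp add: t_def l_def)
  also have "\<dots> \<le> (1 + 41 / 800) * ((1 / 4 + 41 / 400) * s ^ k) * l"
    using t0 t1 t small[of k] gap_bounds(1)[of "k0 + k"] s0
    by (intro mult_mono) (auto simp: l_def local_grad_norm_nonneg algebra_simps)
  \<comment> \<open>The numerical factor is about 0.371; the threshold 1/4 on the gap keeps it below
    1/2.\<close>
  also have "\<dots> \<le> (1 / 2 * s ^ k) * l"
    using s0 local_grad_norm_nonneg by (intro mult_right_mono) (auto simp: l_def)
  also have "\<dots> \<le> (1 / 2 * s ^ k)
      * (s ^ (k * (k - 1) div 2) * (1 / 2) ^ k * (1 - 1 / (2 * \<kappa>)) ^ k0 * lam 0)"
    using s0 Suc.IH by (intro mult_left_mono) (auto simp: l_def)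
  also have "\<dots> = s ^ (k * (k - 1) div 2 + k) * (1 / 2) ^ Suc k * (1 - 1 / (2 * \<kappa>)) ^ k0 * lam 0"
    by (simp add: power_add)
  also have "k * (k - 1) div 2 + k = Suc k * (Suc k - 1) div 2"
    by (cases k) (auto simp: algebra_simps)
  finally show ?case .
qed

end

section \<open>Measurability\<close>

lemma borel_measurable_vecI:
  fixes f :: "'a \<Rightarrow> 'b::euclidean_space^'n"
  assumes "\<And>i. (\<lambda>\<omega>. f \<omega> $ i) \<in> borel_measurable N"
  shows "f \<in> borel_measurable N"
  unfolding borel_measurable_euclidean_space[of f] Basis_vec_def
  using assms by (auto simp: inner_axis)

lemma borel_measurable_nth [measurable (raw)]:
  fixes f :: "'a \<Rightarrow> 'b::euclidean_space^'n"
  assumes "f \<in> borel_measurable N"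
  shows "(\<lambda>\<omega>. f \<omega> $ i) \<in> borel_measurable N"
  by (rule borel_measurable_continuous_on[OF _ assms]) (intro continuous_intros)

lemma borel_measurable_matrix_vector_mult [measurable (raw)]:
  fixes A :: "'a \<Rightarrow> real^'n^'n"
  assumes [measurable]: "A \<in> borel_measurable N" "v \<in> borel_measurable N"
  shows "(\<lambda>\<omega>. A \<omega> *v v \<omega>) \<in> borel_measurable N"
  by (rule borel_measurable_vecI) (simp add: matrix_vector_mult_def)

lemma borel_measurable_matrix_mult [measurable (raw)]:
  fixes A :: "'a \<Rightarrow> real^'n^'n"
  assumes [measurable]: "A \<in> borel_measurable N" "B \<in> borel_measurable N"
  shows "(\<lambda>\<omega>. A \<omega> ** B \<omega>) \<in> borel_measurable N"
  by (intro borel_measurable_vecI) (simp add: matrix_matrix_mult_def)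

lemma borel_measurable_outer [measurable (raw)]:
  assumes [measurable]: "a \<in> borel_measurable N" "b \<in> borel_measurable N"
  shows "(\<lambda>\<omega>. outer (a \<omega>) (b \<omega>)) \<in> borel_measurable N"
  by (intro borel_measurable_vecI) (simp add: outer_def)

lemma borel_measurable_trace [measurable (raw)]:
  fixes A :: "'a \<Rightarrow> real^'n^'n"
  assumes [measurable]: "A \<in> borel_measurable N"
  shows "(\<lambda>\<omega>. trace (A \<omega>)) \<in> borel_measurable N"
  unfolding trace_def by measurable

lemma borel_measurable_det:
  fixes A :: "'a \<Rightarrow> real^'n^'n"
  assumes [measurable]: "\<And>i j. (\<lambda>\<omega>. A \<omega> $ i $ j) \<in> borel_measurable N"
  shows "(\<lambda>\<omega>. det (A \<omega>)) \<in> borel_measurable N"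
  unfolding det_def by measurable

text \<open>Cramer's rule writes the entries as quotients of polynomials in the entries of
  \<open>A\<close>, which gives measurability of the inverse.\<close>

lemma matrix_inv_entry:
  fixes A :: "real^'n^'n"
  assumes "pos_def A"
  shows "matrix_inv A $ k $ l = det (\<chi> i j. if j = k then axis l 1 $ i else A $ i $ j) / det A"
proof -
  have "det A \<noteq> 0" using pos_def_inv(1)[OF assms] invertible_det_nz by blast
  from cramer[OF this, of "matrix_inv A *v axis l 1" "axis l 1"]
  have "matrix_inv A *v axis l 1
      = (\<chi> k. det (\<chi> i j. if j = k then axis l 1 $ i else A $ i $ j) / det A)"
    by (simp add: pos_def_mult_inv(1)[OF assms])
  then have "(matrix_inv A *v axis l 1) $ k
      = det (\<chi> i j. if j = k then axis l 1 $ i else A $ i $ j) / det A"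
    by simp
  then show ?thesis by (simp add: matrix_vector_mul_component inner_axis)
qed

lemma borel_measurable_matrix_inv:
  fixes A :: "'a \<Rightarrow> real^'n^'n"
  assumes [measurable]: "A \<in> borel_measurable N" and pd: "\<And>\<omega>. \<omega> \<in> space N \<Longrightarrow> pos_def (A \<omega>)"
  shows "(\<lambda>\<omega>. matrix_inv (A \<omega>)) \<in> borel_measurable N"
proof (intro borel_measurable_vecI)
  fix k l
  have [measurable]: "(\<lambda>\<omega>. det (\<chi> i j. if j = k then axis l 1 $ i else A \<omega> $ i $ j)) \<in> borel_measurable N"
    by (rule borel_measurable_det) simp
  have [measurable]: "(\<lambda>\<omega>. det (A \<omega>)) \<in> borel_measurable N"
    by (rule borel_measurable_det) simp
  have "(\<lambda>\<omega>. det (\<chi> i j. if j = k then axis l 1 $ i else A \<omega> $ i $ j) / det (A \<omega>)) \<in> borel_measurable N"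
    by measurable
  then show "(\<lambda>\<omega>. matrix_inv (A \<omega>) $ k $ l) \<in> borel_measurable N"
    by (subst measurable_cong[OF matrix_inv_entry[OF pd]])
qed

lemma borel_measurable_broyd [measurable (raw)]:
  fixes G A :: "'a \<Rightarrow> real^'n^'n"
  assumes [measurable]: "\<tau> \<in> borel_measurable N" "G \<in> borel_measurable N" "A \<in> borel_measurable N"
    "u \<in> borel_measurable N"
  shows "(\<lambda>\<omega>. broyd (\<tau> \<omega>) (G \<omega>) (A \<omega>) (u \<omega>)) \<in> borel_measurable N"
proof -
  \<comment> \<open>Equality of vectors becomes the vanishing of a real measurable function.\<close>
  have eq: "(G \<omega> *v u \<omega> = A \<omega> *v u \<omega>) = (norm (G \<omega> *v u \<omega> - A \<omega> *v u \<omega>) = 0)" for \<omega>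
    by simp
  show ?thesis
    unfolding broyd_def Let_def eq by measurable
qed

context self_concordant_objective
begin

text \<open>Twofold differentiability gives no continuity of the Hessian. Strong self-concordance
  bounds its variation in local norms, and smoothness turns these into Euclidean ones.\<close>

lemma hess_lipschitz: "(M * sqrt L * L)-lipschitz_on UNIV (\<lambda>x. hess f x $ i $ j)"
proof (rule lipschitz_onI)
  show "0 \<le> M * sqrt L * L" using M_pos L_pos by simp
  have one: "pos_def (mat 1 :: real^'n^'n)" by (simp add: pos_def_def transpose_mat)
  have le: "hess f y $ i $ j - hess f x $ i $ j \<le> M * sqrt L * L * norm (y - x)" for x y
  proof -
    define c where "c = M * sqrt L * L * norm (y - x)"
    have "local_norm f x (y - x) \<le> sqrt (L * (norm (y - x))\<^sup>2)"
      unfolding local_norm_def using hess_le[of "y - x" x] by (simp add: power2_norm_eq_inner)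
    then have ln: "local_norm f x (y - x) \<le> sqrt L * norm (y - x)"
      by (simp add: real_sqrt_mult)
    have bd: "M * local_norm f x (y - x) * (h \<bullet> (hess f w *v h)) \<le> c * (h \<bullet> (mat 1 *v h))" for h w
    proof -
      have "M * local_norm f x (y - x) * (h \<bullet> (hess f w *v h)) \<le> M * (sqrt L * norm (y - x)) * (L * (h \<bullet> h))"
        using ln M_pos L_pos
        by (intro mult_mono mult_left_mono hess_le pos_semidef_ge_0[OF psd_hess]) auto
      then show ?thesis by (simp add: c_def mult_ac)
    qed
    have up: "h \<bullet> ((hess f y - hess f x) *v h) \<le> c * (h \<bullet> (mat 1 *v h))" for h
      using order_trans[OF hess_diff_le bd] .
    have lo: "- (h \<bullet> ((hess f y - hess f x) *v h)) \<le> c * (h \<bullet> (mat 1 *v h))" for h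
      using order_trans[OF hess_diff_le[of h x y x x, unfolded local_norm_minus[of x x y]] bd]
      by (simp add: matrix_vector_mult_diff_rdistrib inner_diff_right)
    have "axis i 1 \<bullet> ((hess f y - hess f x) *v axis j 1)
        \<le> c * (sqrt (axis i 1 \<bullet> (mat 1 *v (axis i 1 :: real^'n))) * sqrt (axis j 1 \<bullet> (mat 1 *v (axis j 1 :: real^'n))))"
      by (rule bilinear_bound[OF _ one _ up lo])
        (use M_pos L_pos in \<open>auto simp: c_def transpose_diff transpose_hess\<close>)
    then show ?thesis
      by (simp add: inner_axis' inner_axis_axis matrix_vector_mul_component inner_axis c_def)
  qed
  fix x y
  show "dist (hess f x $ i $ j) (hess f y $ i $ j) \<le> M * sqrt L * L * dist x y"
    using le[of x y] le[of y x] by (simp add: dist_norm norm_minus_commute abs_le_iff)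
qed

lemma borel_measurable_hess [measurable (raw)]:
  assumes "g \<in> borel_measurable N"
  shows "(\<lambda>\<omega>. hess f (g \<omega>)) \<in> borel_measurable N"
  by (intro borel_measurable_vecI)
    (rule borel_measurable_continuous_on[OF lipschitz_on_continuous_on[OF hess_lipschitz] assms])

lemma borel_measurable_grad [measurable (raw)]:
  assumes "g \<in> borel_measurable N"
  shows "(\<lambda>\<omega>. grad f (g \<omega>)) \<in> borel_measurable N"
proof -
  have "continuous_on UNIV (grad f)"
    using has_derivative_continuous[OF grad_has_derivative[OF twice_diff]]
    by (simp add: continuous_at_imp_continuous_on)
  then show ?thesis by (rule borel_measurable_continuous_on[OF _ assms])
qed

lemma borel_measurable_inv_hess [measurable (raw)]:
  assumes [measurable]: "g \<in> borel_measurable N"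
  shows "(\<lambda>\<omega>. matrix_inv (hess f (g \<omega>))) \<in> borel_measurable N"
  by (rule borel_measurable_matrix_inv) (simp_all add: pos_def_hess)

lemma borel_measurable_local_norm [measurable (raw)]:
  assumes [measurable]: "g \<in> borel_measurable N" "h \<in> borel_measurable N"
  shows "(\<lambda>\<omega>. local_norm f (g \<omega>) (h \<omega>)) \<in> borel_measurable N"
  unfolding local_norm_def by measurable

lemma borel_measurable_local_grad_norm [measurable (raw)]:
  assumes [measurable]: "g \<in> borel_measurable N"
  shows "(\<lambda>\<omega>. local_grad_norm f (g \<omega>)) \<in> borel_measurable N"
  unfolding local_grad_norm_def by measurable

end

section \<open>Expected decrease of the gap\<close>

lemma abs_component_ratio_le_1:
  fixes v :: "real^'n"
  shows "\<bar>v $ i * v $ j / (v \<bullet> v)\<bar> \<le> 1"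
proof (cases "v = 0")
  case False
  have "\<bar>v $ i * v $ j\<bar> \<le> norm v * norm v"
    unfolding abs_mult by (intro mult_mono component_le_norm_cart) auto
  also have "\<dots> = v \<bullet> v" by (simp flip: power2_eq_square power2_norm_eq_inner)
  finally show ?thesis using False by (simp add: divide_le_eq)
qed simp

lemma isotropic_directions_component:
  fixes D :: "(real^'n) measure"
  assumes "isotropic_directions D"
  shows "(\<integral>v. v $ i * v $ j / (v \<bullet> v) \<partial>D) = (if i = j then 1 / CARD('n) else 0)"
proof -
  interpret prob_space D using assms by (simp add: isotropic_directions_def)
  have sD [measurable_cong]: "sets D = sets borel" using assms by (simp add: isotropic_directions_def)
  have meas: "(\<lambda>v. v $ k * v $ l / (v \<bullet> v)) \<in> borel_measurable D" for k l :: 'n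
    by measurable
  have int: "integrable D (\<lambda>v. v $ k * v $ l / (v \<bullet> v))" for k l :: 'n
    by (rule integrable_const_bound[of _ 1]) (simp_all add: abs_component_ratio_le_1 meas del: abs_divide)
  \<comment> \<open>Taking an entry commutes with the Bochner integral of an integrable function;
    the entries are bounded by 1.\<close>
  have "integrable D (\<lambda>v. (1 / (v \<bullet> v)) *\<^sub>R outer v v)"
  proof (rule integrable_const_bound[of _ "real CARD('n) * real CARD('n)"])
    have "norm ((1 / (v \<bullet> v)) *\<^sub>R outer v v) \<le> real CARD('n) * real CARD('n)" for v :: "real^'n"
    proof -
      have "norm ((1 / (v \<bullet> v)) *\<^sub>R outer v v) \<le> (\<Sum>k\<in>UNIV. norm (((1 / (v \<bullet> v)) *\<^sub>R outer v v) $ k))"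
        unfolding norm_vec_def by (rule L2_set_le_sum) simp
      also have "\<dots> \<le> (\<Sum>k\<in>UNIV. \<Sum>l\<in>UNIV. \<bar>((1 / (v \<bullet> v)) *\<^sub>R outer v v) $ k $ l\<bar>)"
        by (intro sum_mono norm_le_l1_cart)
      also have "\<dots> \<le> (\<Sum>k\<in>(UNIV :: 'n set). \<Sum>l\<in>(UNIV :: 'n set). 1)"
        using abs_component_ratio_le_1[of v] by (intro sum_mono) (simp add: outer_def)
      finally show ?thesis by simp
    qed
    then show "AE v in D. norm ((1 / (v \<bullet> v)) *\<^sub>R outer v v) \<le> real CARD('n) * real CARD('n)" by simp
  qed measurable
  moreover have "bounded_linear (\<lambda>A :: real^'n^'n. A $ i $ j)"
    by (intro bounded_linear_compose[OF bounded_linear_vec_nth bounded_linear_vec_nth])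
  ultimately have "(\<integral>v. ((1 / (v \<bullet> v)) *\<^sub>R outer v v) $ i $ j \<partial>D)
      = (\<integral>v. (1 / (v \<bullet> v)) *\<^sub>R outer v v \<partial>D) $ i $ j"
    by (intro integral_bounded_linear)
  also have "\<dots> = mat (1 / real CARD('n)) $ i $ j"
    using assms by (simp add: isotropic_directions_def)
  finally show ?thesis by (simp add: outer_def mat_def)
qed

locale random_quasi_newton = self_concordant_objective f M \<mu> L
  for f :: "real^'n \<Rightarrow> real" and M \<mu> L :: real +
  fixes \<kappa> N :: real and P :: "'w measure" and F :: "nat \<Rightarrow> 'w measure" and D :: "(real^'n) measure"
    and u :: "nat \<Rightarrow> 'w \<Rightarrow> real^'n" and \<tau> :: "nat \<Rightarrow> 'w \<Rightarrow> real"
    and x0 :: "real^'n" and x :: "nat \<Rightarrow> 'w \<Rightarrow> real^'n" and G :: "nat \<Rightarrow> 'w \<Rightarrow> real^'n^'n"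
  assumes dim: "2 \<le> CARD('n)"
    and \<kappa>: "\<kappa> = L / \<mu>" and N: "N = CARD('n) * \<kappa>"
    and isotropic: "isotropic_directions D"
    and sampling: "direction_sampling P F D u \<tau>"
    and runs: "\<And>\<omega>. \<omega> \<in> space P \<Longrightarrow>
           quasi_newton_run f M x0 (mat L) (\<lambda>k. u k \<omega>) (\<lambda>k. \<tau> k \<omega>) (\<lambda>k. x k \<omega>) (\<lambda>k. G k \<omega>)"
    and start: "M * local_grad_norm f x0 \<le> ln (3 / 2) / (4 * \<kappa>)"

sublocale random_quasi_newton \<subseteq> prob_space P
  using sampling by (simp add: direction_sampling_def)

context random_quasi_newton
begin

abbreviation "rate \<equiv> 1 - 51 / (100 * \<kappa>)"
abbreviation "q \<equiv> 1 - 1 / N"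

definition gap :: "nat \<Rightarrow> 'w \<Rightarrow> real" where
  "gap k \<omega> = quasi_newton.gap f (\<lambda>k. x k \<omega>) (\<lambda>k. G k \<omega>) k"
definition gap_mid :: "nat \<Rightarrow> 'w \<Rightarrow> real" where
  "gap_mid k \<omega> = quasi_newton.gap_mid f M (\<lambda>k. x k \<omega>) (\<lambda>k. G k \<omega>) k"
definition resid :: "nat \<Rightarrow> 'w \<Rightarrow> real^'n^'n" where
  "resid k \<omega> = quasi_newton.resid f M (\<lambda>k. x k \<omega>) (\<lambda>k. G k \<omega>) k"

lemma quasi_newton:
  assumes "\<omega> \<in> space P"
  shows "quasi_newton f M \<mu> L \<kappa> x0 (\<lambda>k. u k \<omega>) (\<lambda>k. \<tau> k \<omega>) (\<lambda>k. x k \<omega>) (\<lambda>k. G k \<omega>)"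
proof -
  have "\<tau> k \<omega> \<in> {0..1}" for k using sampling assms unfolding direction_sampling_def by blast
  then show ?thesis
    by unfold_locales (use \<kappa> runs[OF assms] start in auto)
qed

lemma \<kappa>_ge_1: "1 \<le> \<kappa>"
  using condition_number_ge_1 by (simp add: \<kappa>)

lemma N_ge: "2 * \<kappa> \<le> N" "2 \<le> N"
proof -
  show *: "2 * \<kappa> \<le> N" unfolding N using dim \<kappa>_ge_1 by (intro mult_right_mono) auto
  show "2 \<le> N" using * \<kappa>_ge_1 by linarith
qed

lemma q_pos: "0 < q" using N_ge(2) by simp

lemma rate_nonneg: "0 \<le> rate" using \<kappa>_ge_1 by (simp add: field_simps)

lemma space_F: "space (F k) = space P"
  and sets_F_le: "sets (F k) \<subseteq> sets P"
  using sampling unfolding direction_sampling_def subalgebra_def by auto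

lemma sets_F_mono: "i \<le> j \<Longrightarrow> sets (F i) \<subseteq> sets (F j)"
  using sampling unfolding direction_sampling_def by (auto dest: filtration.sets_F_mono)

lemma measurable_F_Suc: "g \<in> borel_measurable (F k) \<Longrightarrow> g \<in> borel_measurable (F (Suc k))"
  using sets_F_mono[of k "Suc k"] by (auto simp: measurable_def space_F)

lemma measurable_F_P: "g \<in> borel_measurable (F k) \<Longrightarrow> g \<in> borel_measurable P"
  using sets_F_le[of k] by (auto simp: measurable_def space_F)

lemma u_measurable: "u k \<in> borel_measurable (F (Suc k))"
  and \<tau>_measurable: "\<tau> k \<in> borel_measurable (F (Suc k))"
  and distr_u: "distr P borel (u k) = D"
  and indep_u: "indep_set (sets (F k)) (sets (vimage_algebra (space P) (u k) borel))"
  using sampling unfolding direction_sampling_def by auto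

lemma pos_def_G: "\<omega> \<in> space P \<Longrightarrow> pos_def (G k \<omega>)"
  using quasi_newton.pos_def_G[OF quasi_newton] .

text \<open>The next point uses \<open>G k\<close> but not \<open>u k\<close>, so it is known
  already at stage \<open>k\<close>. This places the residual in \<open>F k\<close>.\<close>

lemma x_Suc_measurable:
  assumes [measurable]: "x k \<in> borel_measurable (F k)" "G k \<in> borel_measurable (F k)"
  shows "x (Suc k) \<in> borel_measurable (F k)"
proof -
  have [measurable]: "(\<lambda>\<omega>. matrix_inv (G k \<omega>)) \<in> borel_measurable (F k)"
    by (rule borel_measurable_matrix_inv) (simp_all add: pos_def_G space_F)
  have "(\<lambda>\<omega>. x k \<omega> - matrix_inv (G k \<omega>) *v grad f (x k \<omega>)) \<in> borel_measurable (F k)"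
    by measurable
  then show ?thesis
    by (rule measurable_cong[THEN iffD1, rotated])
      (simp add: space_F quasi_newton.x_Suc[OF quasi_newton])
qed

lemma measurable_F: "x k \<in> borel_measurable (F k) \<and> G k \<in> borel_measurable (F k)"
proof (induction k)
  case 0
  have "x 0 \<in> borel_measurable (F 0) \<longleftrightarrow> (\<lambda>_. x0) \<in> borel_measurable (F 0)"
    by (rule measurable_cong) (simp add: space_F quasi_newton.x_0[OF quasi_newton])
  moreover have "G 0 \<in> borel_measurable (F 0) \<longleftrightarrow> (\<lambda>_. mat L :: real^'n^'n) \<in> borel_measurable (F 0)"
    by (rule measurable_cong) (simp add: space_F quasi_newton.G_0[OF quasi_newton])
  ultimately show ?case by simp
next
  case (Suc k)
  note [measurable] = u_measurable[of k] \<tau>_measurable[of k]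
    measurable_F_Suc[OF Suc[THEN conjunct1]] measurable_F_Suc[OF Suc[THEN conjunct2]]
    measurable_F_Suc[OF x_Suc_measurable[OF Suc[THEN conjunct1] Suc[THEN conjunct2]]]
  have "(\<lambda>\<omega>. broyd (\<tau> k \<omega>) ((1 + M * local_norm f (x k \<omega>) (x (Suc k) \<omega> - x k \<omega>)) *\<^sub>R G k \<omega>)
      (hess f (x (Suc k) \<omega>)) (u k \<omega>)) \<in> borel_measurable (F (Suc k))"
    by measurable
  then have "G (Suc k) \<in> borel_measurable (F (Suc k))"
    by (rule measurable_cong[THEN iffD1, rotated])
      (simp add: space_F quasi_newton.G_Suc[OF quasi_newton] quasi_newton.rho_def[OF quasi_newton])
  then show ?case by simp
qed

lemmas x_measurable_F [measurable] = measurable_F[THEN conjunct1]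
  and G_measurable_F [measurable] = measurable_F[THEN conjunct2]
lemmas x_Suc_measurable_F [measurable] = x_Suc_measurable[OF x_measurable_F G_measurable_F]
lemmas x_measurable [measurable] = measurable_F_P[OF x_measurable_F]
  and G_measurable [measurable] = measurable_F_P[OF G_measurable_F]
  and u_measurable_P [measurable] = measurable_F_P[OF u_measurable]

lemma resid_measurable_F [measurable]: "resid k \<in> borel_measurable (F k)"
proof -
  have "(\<lambda>\<omega>. (1 + M * local_norm f (x k \<omega>) (x (Suc k) \<omega> - x k \<omega>)) *\<^sub>R G k \<omega>
      - hess f (x (Suc k) \<omega>)) \<in> borel_measurable (F k)" by measurable
  then show ?thesis
    by (rule measurable_cong[THEN iffD1, rotated])
      (simp add: space_F resid_def quasi_newton.resid_def[OF quasi_newton] quasi_newton.rho_def[OF quasi_newton])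
qed

lemmas resid_measurable [measurable] = measurable_F_P[OF resid_measurable_F]

lemma gap_measurable [measurable]: "gap k \<in> borel_measurable P"
proof -
  have "(\<lambda>\<omega>. trace (matrix_inv (hess f (x k \<omega>)) ** (G k \<omega> - hess f (x k \<omega>)))) \<in> borel_measurable P"
    by measurable
  then show ?thesis
    by (rule measurable_cong[THEN iffD1, rotated])
      (simp add: gap_def quasi_newton.gap_def[OF quasi_newton])
qed

lemma gap_mid_measurable [measurable]: "gap_mid k \<in> borel_measurable P"
proof -
  have "(\<lambda>\<omega>. trace (matrix_inv (hess f (x (Suc k) \<omega>)) ** resid k \<omega>)) \<in> borel_measurable P"
    by measurable
  then show ?thesis
    by (rule measurable_cong[THEN iffD1, rotated])
      (simp add: gap_mid_def resid_def quasi_newton.gap_mid_def[OF quasi_newton])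
qed

lemma gap_bounds:
  assumes "\<omega> \<in> space P"
  shows "0 \<le> gap k \<omega>" "gap k \<omega> \<le> 3 / 2 * N"
proof -
  note b = quasi_newton.gap_bounds[OF quasi_newton[OF assms], of k, folded gap_def]
  show "0 \<le> gap k \<omega>" by (rule b)
  have "3 / 2 * \<kappa> * CARD('n) = 3 / 2 * N" by (simp add: N)
  then show "gap k \<omega> \<le> 3 / 2 * N" using b(2) by linarith
qed

lemma gap_mid_bounds:
  assumes "\<omega> \<in> space P"
  shows "0 \<le> gap_mid k \<omega>" "gap_mid k \<omega> \<le> gap k \<omega> + CARD('n) / 2 * rate ^ k"
  using quasi_newton.gap_mid_nonneg[OF quasi_newton[OF assms], of k]
    quasi_newton.gap_mid_le[OF quasi_newton[OF assms], of k]
  by (simp_all add: gap_def gap_mid_def)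

lemma integrable_gap: "integrable P (gap k)"
proof (rule integrable_const_bound[of _ "3 / 2 * N"])
  have "norm (gap k \<omega>) \<le> 3 / 2 * N" if "\<omega> \<in> space P" for \<omega>
    using gap_bounds[OF that, of k] unfolding real_norm_def by linarith
  then show "AE \<omega> in P. norm (gap k \<omega>) \<le> 3 / 2 * N" by (rule AE_I2)
qed measurable

lemma integrable_gap_mid: "integrable P (gap_mid k)"
proof (rule integrable_const_bound[of _ "3 / 2 * N + CARD('n) / 2 * rate ^ k"])
  have "norm (gap_mid k \<omega>) \<le> 3 / 2 * N + CARD('n) / 2 * rate ^ k" if "\<omega> \<in> space P" for \<omega>
    using gap_mid_bounds[OF that, of k] gap_bounds(2)[OF that, of k] unfolding real_norm_def by linarith
  then show "AE \<omega> in P. norm (gap_mid k \<omega>) \<le> 3 / 2 * N + CARD('n) / 2 * rate ^ k" by (rule AE_I2)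
qed measurable

lemma integrable_resid: "integrable P (\<lambda>\<omega>. resid k \<omega> $ i $ j)"
proof (rule integrable_const_bound[of _ "2 * (3 / 2 * \<kappa> * L)"])
  have "norm (resid k \<omega> $ i $ j) \<le> 2 * (3 / 2 * \<kappa> * L)" if "\<omega> \<in> space P" for \<omega>
    unfolding real_norm_def resid_def by (rule quasi_newton.resid_entry_le[OF quasi_newton[OF that]])
  then show "AE \<omega> in P. norm (resid k \<omega> $ i $ j) \<le> 2 * (3 / 2 * \<kappa> * L)" by (rule AE_I2)
qed measurable

text \<open>The first variable is measurable with respect to \<open>F k\<close>, the second is a
  function of \<open>u k\<close>; independence passes to the smaller sigma-algebras that they
  generate.\<close>

lemma indep_resid_direction:
  "indep_var borel (\<lambda>\<omega>. resid k \<omega> $ i $ j) borel (\<lambda>\<omega>. u k \<omega> $ i * u k \<omega> $ j / (u k \<omega> \<bullet> u k \<omega>))"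
proof -
  let ?X = "\<lambda>\<omega>. resid k \<omega> $ i $ j" and ?w = "\<lambda>v :: real^'n. v $ i * v $ j / (v \<bullet> v)"
  let ?A = "{?X -` B \<inter> space P | B. B \<in> sets borel}"
    and ?B = "{(\<lambda>\<omega>. ?w (u k \<omega>)) -` B \<inter> space P | B. B \<in> sets borel}"
  have X: "?X \<in> borel_measurable (F k)" by measurable
  have w: "?w \<in> borel_measurable borel" by measurable
  have A: "?A \<subseteq> sets (F k)" using measurable_sets[OF X] by (auto simp: space_F)
  have B: "?B \<subseteq> sets (vimage_algebra (space P) (u k) borel)"
  proof clarify
    fix B :: "real set" assume "B \<in> sets borel"
    then have "?w -` B \<in> sets borel" using measurable_sets[OF w, of B] by simp
    moreover have "(\<lambda>\<omega>. ?w (u k \<omega>)) -` B \<inter> space P = u k -` (?w -` B) \<inter> space P" by auto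
    ultimately show "(\<lambda>\<omega>. ?w (u k \<omega>)) -` B \<inter> space P \<in> sets (vimage_algebra (space P) (u k) borel)"
      by (auto simp: sets_vimage_algebra2)
  qed
  have "sigma_sets (space P) ?A \<subseteq> sets (F k)"
    using sets.sigma_sets_subset[OF A] by (simp add: space_F)
  moreover have "sigma_sets (space P) ?B \<subseteq> sets (vimage_algebra (space P) (u k) borel)"
    using sets.sigma_sets_subset[OF B] by simp
  ultimately have "indep_set (sigma_sets (space P) ?A) (sigma_sets (space P) ?B)"
    using indep_u[of k] unfolding indep_sets2_eq by blast
  moreover have "?X \<in> borel_measurable P" "(\<lambda>\<omega>. ?w (u k \<omega>)) \<in> borel_measurable P" by measurable
  ultimately show ?thesis unfolding indep_var_eq by blast
qed

lemma integrable_direction: "integrable P (\<lambda>\<omega>. u k \<omega> $ i * u k \<omega> $ j / (u k \<omega> \<bullet> u k \<omega>))"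
proof (rule integrable_const_bound[of _ 1])
  show "AE \<omega> in P. norm (u k \<omega> $ i * u k \<omega> $ j / (u k \<omega> \<bullet> u k \<omega>)) \<le> 1"
    by (rule AE_I2) (simp only: real_norm_def abs_component_ratio_le_1)
qed measurable

lemma expectation_direction:
  "expectation (\<lambda>\<omega>. u k \<omega> $ i * u k \<omega> $ j / (u k \<omega> \<bullet> u k \<omega>)) = (if i = j then 1 / CARD('n) else 0)"
proof -
  have "expectation (\<lambda>\<omega>. u k \<omega> $ i * u k \<omega> $ j / (u k \<omega> \<bullet> u k \<omega>))
      = (\<integral>v. v $ i * v $ j / (v \<bullet> v) \<partial>distr P borel (u k))"
    by (subst integral_distr) measurable
  then show ?thesis by (simp only: distr_u isotropic_directions_component[OF isotropic])
qed

lemma quadratic_form_ratio: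
  fixes R :: "real^'n^'n"
  shows "(v \<bullet> (R *v v)) / (v \<bullet> v) = (\<Sum>i\<in>UNIV. \<Sum>j\<in>UNIV. R $ i $ j * (v $ i * v $ j / (v \<bullet> v)))"
  by (simp add: inner_vec_def matrix_vector_mult_def sum_divide_distrib sum_distrib_left mult_ac)

lemma resid_direction_integrable:
  "integrable P (\<lambda>\<omega>. resid k \<omega> $ i $ j * (u k \<omega> $ i * u k \<omega> $ j / (u k \<omega> \<bullet> u k \<omega>)))"
  by (rule indep_var_integrable[OF indep_resid_direction integrable_resid integrable_direction])

lemma integrable_trace_resid: "integrable P (\<lambda>\<omega>. trace (resid k \<omega>))"
  unfolding trace_def by (intro Bochner_Integration.integrable_sum integrable_resid)

lemma integrable_quadratic:
  "integrable P (\<lambda>\<omega>. (u k \<omega> \<bullet> (resid k \<omega> *v u k \<omega>)) / (u k \<omega> \<bullet> u k \<omega>))"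
  unfolding quadratic_form_ratio
  by (intro Bochner_Integration.integrable_sum resid_direction_integrable)

text \<open>Expanding into entries replaces a conditional expectation by finitely many products of
  independent real variables; isotropy keeps the diagonal ones.\<close>

lemma expectation_quadratic:
  "expectation (\<lambda>\<omega>. (u k \<omega> \<bullet> (resid k \<omega> *v u k \<omega>)) / (u k \<omega> \<bullet> u k \<omega>))
    = expectation (\<lambda>\<omega>. trace (resid k \<omega>)) / CARD('n)"
proof -
  have "expectation (\<lambda>\<omega>. (u k \<omega> \<bullet> (resid k \<omega> *v u k \<omega>)) / (u k \<omega> \<bullet> u k \<omega>))
    = (\<Sum>i\<in>UNIV. \<Sum>j\<in>UNIV. expectation (\<lambda>\<omega>. resid k \<omega> $ i $ j * (u k \<omega> $ i * u k \<omega> $ j / (u k \<omega> \<bullet> u k \<omega>))))"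
    unfolding quadratic_form_ratio
    by (simp only: Bochner_Integration.integral_sum resid_direction_integrable Bochner_Integration.integrable_sum)
  also have "\<dots> = (\<Sum>i\<in>UNIV. \<Sum>j\<in>UNIV. expectation (\<lambda>\<omega>. resid k \<omega> $ i $ j) * (if i = j then 1 / CARD('n) else 0))"
    by (simp only: indep_var_lebesgue_integral[OF indep_resid_direction integrable_resid integrable_direction]
        expectation_direction)
  also have "\<dots> = (\<Sum>i\<in>UNIV. expectation (\<lambda>\<omega>. resid k \<omega> $ i $ i)) / CARD('n)"
    by (simp add: if_distrib sum_divide_distrib cong: if_cong)
  also have "(\<Sum>i\<in>UNIV. expectation (\<lambda>\<omega>. resid k \<omega> $ i $ i)) = expectation (\<lambda>\<omega>. trace (resid k \<omega>))"
    unfolding trace_def by (simp only: Bochner_Integration.integral_sum integrable_resid)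
  finally show ?thesis .
qed

lemma expectation_gap_Suc:
  "expectation (gap (Suc k)) \<le> q * (expectation (gap k) + CARD('n) / 2 * rate ^ k)"
proof -
  let ?Q = "\<lambda>\<omega>. (u k \<omega> \<bullet> (resid k \<omega> *v u k \<omega>)) / (u k \<omega> \<bullet> u k \<omega>)"
  have "expectation (gap (Suc k)) \<le> expectation (\<lambda>\<omega>. gap_mid k \<omega> - (1 / L) * ?Q \<omega>)"
  proof (rule integral_mono[OF integrable_gap])
    show "integrable P (\<lambda>\<omega>. gap_mid k \<omega> - (1 / L) * ?Q \<omega>)"
      by (intro Bochner_Integration.integrable_diff integrable_mult_right integrable_gap_mid integrable_quadratic)
    show "gap (Suc k) \<omega> \<le> gap_mid k \<omega> - (1 / L) * ?Q \<omega>" if "\<omega> \<in> space P" for \<omega>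
      using quasi_newton.gap_Suc_le[OF quasi_newton[OF that], of k]
      by (simp add: gap_def gap_mid_def resid_def)
  qed
  also have "\<dots> = expectation (gap_mid k) - (1 / L) * expectation ?Q"
    by (simp only: Bochner_Integration.integral_diff integrable_mult_right integrable_gap_mid
        integrable_quadratic integral_mult_right_zero)
  also have "\<dots> = expectation (gap_mid k) - (1 / L) * (expectation (\<lambda>\<omega>. trace (resid k \<omega>)) / CARD('n))"
    by (simp only: expectation_quadratic)
  also have "\<dots> \<le> expectation (gap_mid k) - (1 / L) * ((\<mu> * expectation (gap_mid k)) / CARD('n))"
  proof -
    have "\<mu> * expectation (gap_mid k) = expectation (\<lambda>\<omega>. \<mu> * gap_mid k \<omega>)" by simp
    also have "\<dots> \<le> expectation (\<lambda>\<omega>. trace (resid k \<omega>))"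
    proof (rule integral_mono)
      show "\<mu> * gap_mid k \<omega> \<le> trace (resid k \<omega>)" if "\<omega> \<in> space P" for \<omega>
        using quasi_newton.trace_resid_ge[OF quasi_newton[OF that], of k]
        by (simp add: gap_mid_def resid_def)
    qed (auto intro: integrable_gap_mid integrable_trace_resid)
    finally show ?thesis
      using L_pos by (intro diff_left_mono mult_left_mono divide_right_mono) auto
  qed
  \<comment> \<open>The three losses combine: \<open>\<mu> / (L * CARD('n)) = 1 / N\<close>.\<close>
  also have "\<dots> = q * expectation (gap_mid k)"
    using L_pos \<mu>_pos by (simp add: N \<kappa> field_simps)
  also have "\<dots> \<le> q * (expectation (gap k) + CARD('n) / 2 * rate ^ k)"
  proof (rule mult_left_mono[OF _ less_imp_le[OF q_pos]])
    have "expectation (gap_mid k) \<le> expectation (\<lambda>\<omega>. gap k \<omega> + CARD('n) / 2 * rate ^ k)"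
      by (intro integral_mono gap_mid_bounds(2) integrable_gap_mid Bochner_Integration.integrable_add
          integrable_gap integrable_const)
    also have "\<dots> = expectation (gap k) + CARD('n) / 2 * rate ^ k"
      using integrable_gap by (simp add: prob_space)
    finally show "expectation (gap_mid k) \<le> expectation (gap k) + CARD('n) / 2 * rate ^ k" .
  qed
  finally show ?thesis .
qed

text \<open>Since \<open>rate < q\<close>, adding the multiple \<open>50 N rate\<^sup>k\<close> absorbs the drift term of
  \<open>expectation_gap_Suc\<close>.\<close>

lemma expectation_gap_le: "expectation (gap k) \<le> 52 * N * q ^ k"
proof -
  have "expectation (gap k) + 50 * N * rate ^ k \<le> 52 * N * q ^ k"
  proof (induction k)
    case 0
    \<comment> \<open>The initial gap takes 3/2 and the added multiple 50, rounded up to 52.\<close>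
    have "expectation (gap 0) \<le> expectation (\<lambda>_. 3 / 2 * N)"
      by (rule integral_mono[OF integrable_gap integrable_const gap_bounds(2)])
    then show ?case using N_ge(2) by (simp add: prob_space)
  next
    case (Suc k)
    have drift: "q * (CARD('n) / 2) + 50 * N * rate \<le> q * (50 * N)"
    proof -
      \<comment> \<open>The multiple 50 is exact in dimension 2, where both sides equal 1.\<close>
      have "real CARD('n) / 2 \<le> 50 * (51 / 100 * CARD('n) - 1)" using dim by simp
      also have "\<dots> = 50 * N * (q - rate)" using \<kappa>_ge_1 dim by (simp add: N field_simps)
      finally have "real CARD('n) / 2 \<le> 50 * N * (q - rate)" .
      moreover have "q * (CARD('n) / 2) \<le> 1 * (CARD('n) / 2)"
        using N_ge(2) by (intro mult_right_mono) auto
      ultimately have "q * (CARD('n) / 2) \<le> 50 * N * (q - rate)" by linarith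
      then show ?thesis by (simp only: right_diff_distrib mult.commute[of q "50 * N"])
    qed
    have "expectation (gap (Suc k)) + 50 * N * rate ^ Suc k
        \<le> q * expectation (gap k) + (q * (CARD('n) / 2) + 50 * N * rate) * rate ^ k"
      using expectation_gap_Suc[of k] by (simp only: power_Suc distrib_left distrib_right mult.assoc)
    also have "\<dots> \<le> q * expectation (gap k) + (q * (50 * N)) * rate ^ k"
      by (intro add_left_mono mult_right_mono drift zero_le_power rate_nonneg)
    also have "\<dots> = q * (expectation (gap k) + 50 * N * rate ^ k)"
      by (simp only: distrib_left mult.assoc)
    also have "\<dots> \<le> q * (52 * N * q ^ k)"
      using Suc q_pos by (intro mult_left_mono) auto
    finally show ?case by (simp only: power_Suc mult_ac)
  qed
  moreover have "0 \<le> 50 * N * rate ^ k" using N_ge(2) rate_nonneg by (intro mult_nonneg_nonneg) auto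
  ultimately show ?thesis by linarith
qed

text \<open>Markov's inequality at each step; the union bound is summable because
  \<open>q / (1 - 1 / (N + 1)) = 1 - 1 / N\<^sup>2\<close>.\<close>

lemma prob_gap_large:
  "measure P (\<Union>j. {\<omega> \<in> space P. (1 - 1 / (N + 1)) ^ j / 4 \<le> gap (k0 + j) \<omega>}) \<le> 208 * N ^ 3 * q ^ k0"
proof -
  define s r where "s = 1 - 1 / (N + 1)" and "r = 1 - 1 / N\<^sup>2"
  note N = N_ge(2)
  have s: "0 < s" using N by (simp add: s_def)
  have r: "0 \<le> r" "r < 1" using N by (simp_all add: r_def power2_eq_square mult_ge1_I)
  have "q / s = r" using N by (simp add: s_def r_def field_simps power2_eq_square)
  then have qs: "q = r * s" using s by (simp add: field_simps)
  let ?B = "\<lambda>j. {\<omega> \<in> space P. s ^ j / 4 \<le> gap (k0 + j) \<omega>}"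
  \<comment> \<open>Here 208 is \<open>4 * 52\<close>, with 4 from the threshold
    \<open>s ^ j / 4\<close>; its power cancels against
    \<open>q ^ j = r ^ j * s ^ j\<close>.\<close>
  have B: "measure P (?B j) \<le> 208 * N * q ^ k0 * r ^ j" for j
  proof -
    have "measure P (?B j) \<le> expectation (gap (k0 + j)) / (s ^ j / 4)"
      by (rule integral_Markov_inequality_measure[OF integrable_gap, of "{}"])
        (auto intro!: AE_I2 gap_bounds simp: s)
    also have "\<dots> \<le> 52 * N * q ^ (k0 + j) / (s ^ j / 4)"
      using s by (intro divide_right_mono expectation_gap_le) auto
    also have "q ^ (k0 + j) = q ^ k0 * r ^ j * s ^ j"
      by (simp only: power_add qs power_mult_distrib mult.assoc)
    finally show ?thesis using s by simp
  qed
  have sums: "(\<lambda>j. 208 * N * q ^ k0 * r ^ j) sums (208 * N * q ^ k0 * (1 / (1 - r)))"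
    using r by (intro sums_mult geometric_sums) auto
  have summ: "summable (\<lambda>j. measure P (?B j))"
    by (rule summable_comparison_test'[OF sums_summable[OF sums], of 0]) (use B in auto)
  have "measure P (\<Union>j. ?B j) \<le> (\<Sum>j. measure P (?B j))"
    by (rule finite_measure_subadditive_countably[OF _ summ]) auto
  also have "\<dots> \<le> 208 * N * q ^ k0 * (1 / (1 - r))"
    using suminf_le[OF B summ sums_summable[OF sums]] sums_unique[OF sums] by simp
  \<comment> \<open>Summing the series costs \<open>1 / (1 - r) = N\<^sup>2\<close>, which enters
    \<open>k0\<close> only through a logarithm.\<close>
  also have "\<dots> = 208 * N ^ 3 * q ^ k0"
    by (simp add: r_def power3_eq_cube power2_eq_square)
  finally show ?thesis by (simp add: s_def)
qed

lemma superlinear_prob: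
  "measure P {\<omega> \<in> space P. \<forall>k. local_grad_norm f (x (k0 + k) \<omega>)
      \<le> (1 - 1 / (N + 1)) ^ (k * (k - 1) div 2) * (1 / 2) ^ k
         * (1 - 1 / (2 * \<kappa>)) ^ k0 * local_grad_norm f x0}
    \<ge> 1 - 208 * N ^ 3 * q ^ k0" (is "measure P ?good \<ge> _")
proof -
  let ?bad = "\<Union>j. {\<omega> \<in> space P. (1 - 1 / (N + 1)) ^ j / 4 \<le> gap (k0 + j) \<omega>}"
  have sets: "?bad \<in> sets P" by measurable
  have "space P - ?bad \<subseteq> ?good"
  proof
    fix \<omega> assume \<omega>: "\<omega> \<in> space P - ?bad"
    interpret qn: quasi_newton f M \<mu> L \<kappa> x0 "\<lambda>k. u k \<omega>" "\<lambda>k. \<tau> k \<omega>" "\<lambda>k. x k \<omega>" "\<lambda>k. G k \<omega>"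
      using \<omega> by (intro quasi_newton) simp
    have "qn.gap (k0 + j) \<le> (1 - 1 / (N + 1)) ^ j / 4" for j
      using \<omega> by (auto simp: gap_def not_le intro: less_imp_le)
    from qn.superlinear[of "real CARD('n)", folded N, OF _ this] dim qn.x_0 \<omega> show "\<omega> \<in> ?good" by simp
  qed
  then have "measure P (space P - ?bad) \<le> measure P ?good"
    by (rule finite_measure_mono) measurable
  then show ?thesis using prob_compl[OF sets] prob_gap_large[of k0] by linarith
qed

end

text \<open>Since \<open>1 - 1 / N \<le> exp (- (1 / N))\<close>, any
  \<open>k0 \<ge> N * ln (208 * N ^ 3 / \<delta>)\<close> suffices. As
  \<open>N / \<delta> \<ge> 2\<close>, its eighth power absorbs 208 and its cube absorbs
  \<open>N ^ 3 / \<delta>\<close>, so the logarithm is at most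
  \<open>11 * ln (N / \<delta>)\<close>.\<close>

lemma burn_in_exists:
  fixes N \<delta> :: real
  assumes N: "2 \<le> N" and \<delta>: "0 < \<delta>" "\<delta> < 1"
  obtains k0 :: nat where "real k0 \<le> 100 * (N * ln (N / \<delta>))" and "208 * N ^ 3 * (1 - 1 / N) ^ k0 \<le> \<delta>"
proof -
  define l where "l = ln (208 * N ^ 3 / \<delta>)"
  define k0 where "k0 = nat \<lceil>N * l\<rceil>"
  have N\<delta>: "2 \<le> N / \<delta>" using assms by (simp add: le_divide_eq)
  have "208 * N ^ 3 / \<delta> \<le> (N / \<delta>) ^ 11"
  proof -
    have "208 * (N ^ 3 / \<delta>) \<le> (N / \<delta>) ^ 8 * (N / \<delta>) ^ 3"
    proof (rule mult_mono)
      have "(2 :: real) ^ 8 \<le> (N / \<delta>) ^ 8" using N\<delta> by (intro power_mono) auto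
      then show "208 \<le> (N / \<delta>) ^ 8" by simp
      have "\<delta> ^ 3 \<le> \<delta> ^ 1" using \<delta> by (intro power_decreasing) auto
      then show "N ^ 3 / \<delta> \<le> (N / \<delta>) ^ 3"
        using N \<delta> unfolding power_divide by (intro divide_left_mono) auto
    qed (use N \<delta> in auto)
    then show ?thesis by (simp flip: power_add)
  qed
  moreover have pos: "0 < 208 * N ^ 3 / \<delta>" using N \<delta> by simp
  ultimately have "l \<le> ln ((N / \<delta>) ^ 11)" unfolding l_def using N\<delta> by (subst ln_le_cancel_iff) auto
  also have "\<dots> = 11 * ln (N / \<delta>)" using N\<delta> by (subst ln_realpow) auto
  finally have l: "l \<le> 11 * ln (N / \<delta>)" .
  have "1 / 2 \<le> ln (2 :: real)" using ln2_ge_two_thirds by simp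
  also have "\<dots> \<le> ln (N / \<delta>)" using N\<delta> by (subst ln_le_cancel_iff) auto
  finally have ln: "1 / 2 \<le> ln (N / \<delta>)" .
  \<comment> \<open>Pays for rounding \<open>N * l\<close> up to an integer; the total constant is
    12, well within 100.\<close>
  have one: "1 \<le> N * ln (N / \<delta>)" using mult_mono[OF N ln] N by simp
  have "208 * N ^ 3 * 1 \<ge> 208 * 2 ^ 3 * (1 :: real)" using N by (intro mult_mono power_mono) auto
  then have "1 \<le> 208 * N ^ 3 / \<delta>" using \<delta> by (simp add: le_divide_eq)
  then have l0: "0 \<le> l" unfolding l_def by simp
  show thesis
  proof (rule that[of k0])
    have "real k0 \<le> N * l + 1" using N l0 by (simp add: k0_def)
    also have "\<dots> \<le> N * (11 * ln (N / \<delta>)) + N * ln (N / \<delta>)"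
      using l N one by (intro add_mono mult_left_mono) auto
    also have "\<dots> \<le> 100 * (N * ln (N / \<delta>))" using one by simp
    finally show "real k0 \<le> 100 * (N * ln (N / \<delta>))" .
    have "(1 - 1 / N) ^ k0 \<le> exp (- (1 / N)) ^ k0"
      using N exp_ge_add_one_self[of "- (1 / N)"] by (intro power_mono) auto
    also have "\<dots> = exp (- (real k0 / N))" by (simp flip: exp_of_nat_mult)
    also have "\<dots> \<le> exp (- l)"
    proof -
      have "N * l \<le> real k0" unfolding k0_def by linarith
      then show ?thesis using N by (simp add: pos_le_divide_eq mult.commute)
    qed
    also have "\<dots> = \<delta> / (208 * N ^ 3)" unfolding l_def exp_minus using pos by simp
    finally have "208 * N ^ 3 * (1 - 1 / N) ^ k0 \<le> 208 * N ^ 3 * (\<delta> / (208 * N ^ 3))"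
      using N by (intro mult_left_mono) auto
    then show "208 * N ^ 3 * (1 - 1 / N) ^ k0 \<le> \<delta>" using N by simp
  qed
qed

theorem corollary12:
  fixes f :: "real^'n \<Rightarrow> real" and M \<mu> L \<kappa> :: real and d :: nat
    and P :: "'w measure" and F :: "nat \<Rightarrow> 'w measure" and D :: "(real^'n) measure"
    and u :: "nat \<Rightarrow> 'w \<Rightarrow> real^'n" and \<tau> :: "nat \<Rightarrow> 'w \<Rightarrow> real"
    and x0 :: "real^'n" and x :: "nat \<Rightarrow> 'w \<Rightarrow> real^'n" and G :: "nat \<Rightarrow> 'w \<Rightarrow> real^'n^'n"
    and \<delta> :: real
  assumes "d = CARD('n)" and "d \<ge> 2"
    and "strongly_self_concordant M f" and "strongly_convex \<mu> f" and "smooth L f"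
    and "\<kappa> = L / \<mu>"
    and "isotropic_directions D" and "direction_sampling P F D u \<tau>"
    and "\<And>\<omega>. \<omega> \<in> space P \<Longrightarrow>
           quasi_newton_run f M x0 (mat L) (\<lambda>k. u k \<omega>) (\<lambda>k. \<tau> k \<omega>) (\<lambda>k. x k \<omega>) (\<lambda>k. G k \<omega>)"
    and "M * local_grad_norm f x0 \<le> ln (3 / 2) / (4 * \<kappa>)"
    and "0 < \<delta>" and "\<delta> < 1"
  shows "\<exists>k0::nat. real k0 \<le> 100 * (d * \<kappa> * ln (d * \<kappa> / \<delta>)) \<and>
           measure P {\<omega> \<in> space P. \<forall>k::nat.
             local_grad_norm f (x (k0 + k) \<omega>)
               \<le> (1 - 1 / (d * \<kappa> + 1)) ^ (k * (k - 1) div 2) * (1 / 2) ^ k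
                  * (1 - 1 / (2 * \<kappa>)) ^ k0 * local_grad_norm f x0} \<ge> 1 - \<delta>"
proof -
  interpret random_quasi_newton f M \<mu> L \<kappa> "d * \<kappa>" P F D u \<tau> x0 x G
    by unfold_locales (use assms in auto)
  obtain k0 :: nat where k0: "real k0 \<le> 100 * (d * \<kappa> * ln (d * \<kappa> / \<delta>))"
    "208 * (d * \<kappa>) ^ 3 * (1 - 1 / (d * \<kappa>)) ^ k0 \<le> \<delta>"
    using burn_in_exists[OF N_ge(2) \<open>0 < \<delta>\<close> \<open>\<delta> < 1\<close>] by blast
  show ?thesis
    using k0 superlinear_prob[of k0] by (intro exI[of _ k0] conjI) linarith+
qed

end
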